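(* Let $G$ be a finite group and $H$ a normal subgroup of $G$. Fix $k\in\mathbb{Z}$, and for $x\in G$, $y\in H$ set $$u_{x,y}=\sqrt{|G|}\,\delta_x(k)\,\rho_y(k+\tfrac12)\in\mathcal{F}_H.$$ Then $\{(u_{x,y},u_{x,y}^* ): x\in G,\ y\in H\}$ is a quasi-basis of the conditional expectation $z_H:\mathcal{F}_H\to\mathcal{A}_{(H,G)}$.
   Context: Let $e$ be the unit of $G$. $\delta_{a,b}$ with two group-element indices and no argument is the Kronecker delta. The Hopf $*$-algebra $D(H;G)$: it is the crossed product of $C(H)$ (complex functions on $H$) with the group algebra $\mathbb{C}G$ under the adjoint action. It has linear basis $(h,g)$, $h\in H$, $g\in G$, with multiplication $(h_1,g_1)(h_2,g_2)=\delta_{h_1g_1,g_1h_2}(h_1,g_1g_2)$, unit $\sum_{h\in H}(h,e)$, $(h,g)^*=(g^{-1}hg,g^{-1})$, coproduct $\Delta(h,g)=\sum_{t\in H}(t,g)\otimes(t^{-1}h,g)$, counit $\varepsilon(h,g)=\delta_{h,e}$, antipode $S(h,g)=(g^{-1}h^{-1}g,g^{-1})$. Put $z_H=\frac1{|G|}\sum_{g\in G}(e,g)\in D(H;G)$. The algebra $\mathcal{F}_{H,loc}$: it is the unital associative complex $*$-algebra with unit $I$ generated by $\delta_g(x)$, $\rho_h(l)$ ($g\in G$, $h\in H$, $x\in\mathbb{Z}$, $l\in\mathbb{Z}+\frac12$) subject to: $\sum_{g\in G}\delta_g(x)=I=\rho_e(l)$; $\delta_{g_1}(x)\delta_{g_2}(x)=\delta_{g_1,g_2}\delta_{g_1}(x)$;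 $\rho_{h_1}(l)\rho_{h_2}(l)=\rho_{h_1h_2}(l)$; $\delta_{g_1}(x)\delta_{g_2}(x')=\delta_{g_2}(x')\delta_{g_1}(x)$; $\rho_h(l)\delta_g(x)=\delta_{hg}(x)\rho_h(l)$ if $l<x$ and $\rho_h(l)\delta_g(x)=\delta_g(x)\rho_h(l)$ if $l>x$; $\rho_{h_1}(l)\rho_{h_2}(l')=\rho_{h_2}(l')\rho_{h_2^{-1}h_1h_2}(l)$ if $l>l'$. The involution is determined by $\delta_g(x)^*=\delta_g(x)$, $\rho_h(l)^*=\rho_{h^{-1}}(l)$. For a finite subset $\Lambda\subseteq\frac12\mathbb{Z}$, $\mathcal{F}_H(\Lambda)$ is the unital subalgebra of $\mathcal{F}_{H,loc}$ generated by $\delta_g(x)$, $\rho_h(l)$ with $g\in G$, $h\in H$, $x\in\Lambda\cap\mathbb{Z}$, $l\in\Lambda\cap(\mathbb{Z}+\frac12)$. The field algebra $\mathcal{F}_H$: consider the increasing intervals $\Lambda_{2n}=\{s\in\frac12\mathbb{Z}:-n+\frac12\le s\le n\}$, $\Lambda_{2n+1}=\{s\in\frac12\mathbb{Z}:-n-\frac12\le s\le n\}$. For $H=G$ the $*$-algebra $\mathcal{F}_G(\Lambda_n)$ is isomorphic to the full matrix algebra $M_{|G|^n}(\mathbb{C})$, and $\mathcal{F}_H(\Lambda_n)$ is a $*$-subalgebra of it, hence a finite-dimensional $C^*$-algebra. The inclusions $\mathcal{F}_H(\Lambda_n)\subseteq\mathcal{F}_H(\Lambda_{n+1})$ are norm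 preserving, and $\mathcal{F}_H=\overline{\bigcup_n\mathcal{F}_H(\Lambda_n)}$ is the $C^*$-inductive limit (the $C^*$-completion of $\mathcal{F}_{H,loc}$). Action: $D(H;G)$ acts on $\mathcal{F}_H$; the action is the continuous extension of the one on $\mathcal{F}_{H,loc}$ determined by $(h,g)\delta_f(x)=\delta_{h,e}\,\delta_{gf}(x)$ for $f\in G$, $(h,g)\rho_t(l)=\delta_{h,gtg^{-1}}\,\rho_h(l)$ for $t\in H$, and the module algebra rules $(ab)(F)=a(b(F))$, $a(F_1F_2)=\sum_{(a)}a_{(1)}(F_1)a_{(2)}(F_2)$, $a(I)=\varepsilon(a)I$; it also satisfies $a(F^* )=(S(a^* )(F))^*$. The map $F\mapsto z_H(F)$ denotes the action of the element $z_H$. The observable algebra is $\mathcal{A}_{(H,G)}=\{F\in\mathcal{F}_H: z_H(F)=F\}$, a unital $C^*$-subalgebra of $\mathcal{F}_H$. A conditional expectation from a unital $C^*$-algebra $B$ onto a unital $C^*$-subalgebra $A$ is a positive linear unital $A$-bimodule map from $B$ onto $A$; it is known that $z_H:\mathcal{F}_H\to\mathcal{A}_{(H,G)}$, $F\mapsto z_H(F)$, is one. A quasi-basis for a conditional expectation $\Gamma:B\to A$ is a finite family $\{(u_1,u_1^* ),\dots,(u_n,u_n^* )\}\subseteq B\times B$ such that $\sum_{i=1}^n u_i\Gamma(u_i^*a)=a=\sum_{i=1}^n\Gamma(au_i)u_i^*$ for all $a\in B$. *)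

theory Defs
  imports Complex_Main "HOL-Algebra.QuotRing" "HOL-Algebra.Module" "HOL-Library.Poly_Mapping"
begin

section \<open>Complex *-algebras, quotients and C*-completions\<close>

record 'a star_algebra = "(complex, 'a) module" +
  adj :: "'a \<Rightarrow> 'a"

text \<open>The map induced on additive cosets of \<open>I\<close> by a map \<open>f\<close> that is additive modulo \<open>I\<close>
  and sends \<open>I\<close> into \<open>I\<close>: it sends \<open>I + a\<close> to \<open>I + f a\<close>.\<close>

definition induced_map ::
  "('a, 'm) ring_scheme \<Rightarrow> 'a set \<Rightarrow> ('a \<Rightarrow> 'a) \<Rightarrow> 'a set \<Rightarrow> 'a set" where
  "induced_map A I f X = I <+>\<^bsub>A\<^esub> (f ` X)"

definition star_quotient :: "'a star_algebra \<Rightarrow> 'a set \<Rightarrow> 'a set star_algebra" where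
  "star_quotient A I =
    \<lparr>carrier = carrier (A Quot I), mult = mult (A Quot I), one = one (A Quot I),
     zero = zero (A Quot I), add = add (A Quot I),
     smult = (\<lambda>c. induced_map A I (smult A c)), adj = induced_map A I (adj A)\<rparr>"

definition cstar_seminorm :: "'a star_algebra \<Rightarrow> ('a \<Rightarrow> real) \<Rightarrow> bool" where
  "cstar_seminorm A p \<longleftrightarrow>
    (\<forall>x\<in>carrier A. 0 \<le> p x) \<and>
    (\<forall>x\<in>carrier A. \<forall>y\<in>carrier A. p (x \<oplus>\<^bsub>A\<^esub> y) \<le> p x + p y) \<and>
    (\<forall>c. \<forall>x\<in>carrier A. p (c \<odot>\<^bsub>A\<^esub> x) = cmod c * p x) \<and>
    (\<forall>x\<in>carrier A. \<forall>y\<in>carrier A. p (x \<otimes>\<^bsub>A\<^esub> y) \<le> p x * p y) \<and>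
    (\<forall>x\<in>carrier A. p (adj A x \<otimes>\<^bsub>A\<^esub> x) = (p x)\<^sup>2)"

text \<open>The largest C*-seminorm. For a *-algebra generated by projections and unitaries the
  supremum is finite. If the *-algebra is an increasing union of finite-dimensional C*-algebras,
  as \<open>local_algebra\<close> below is, then every C*-norm restricts on each of them to its
  unique C*-norm, so that \<open>env_norm\<close> is the C*-norm of the inductive limit.\<close>

definition env_norm :: "'a star_algebra \<Rightarrow> 'a \<Rightarrow> real" where
  "env_norm A x = (SUP p\<in>Collect (cstar_seminorm A). p x)"

text \<open>The completion: Cauchy sequences (with pointwise operations) modulo null sequences.\<close>

definition cauchy_algebra :: "'a star_algebra \<Rightarrow> (nat \<Rightarrow> 'a) star_algebra" where
  "cauchy_algebra A =
    \<lparr>carrier = {s. (\<forall>n. s n \<in> carrier A) \<and>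
       (\<forall>\<epsilon>>0. \<exists>M. \<forall>m\<ge>M. \<forall>n\<ge>M. env_norm A (s m \<ominus>\<^bsub>A\<^esub> s n) < \<epsilon>)},
     mult = (\<lambda>s t n. s n \<otimes>\<^bsub>A\<^esub> t n), one = (\<lambda>n. \<one>\<^bsub>A\<^esub>),
     zero = (\<lambda>n. \<zero>\<^bsub>A\<^esub>), add = (\<lambda>s t n. s n \<oplus>\<^bsub>A\<^esub> t n),
     smult = (\<lambda>c s n. c \<odot>\<^bsub>A\<^esub> s n), adj = (\<lambda>s n. adj A (s n))\<rparr>"

definition null_sequences :: "'a star_algebra \<Rightarrow> (nat \<Rightarrow> 'a) set" where
  "null_sequences A = {s \<in> carrier (cauchy_algebra A). (\<lambda>n. env_norm A (s n)) \<longlonglongrightarrow> 0}"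

definition cstar_completion :: "'a star_algebra \<Rightarrow> (nat \<Rightarrow> 'a) set star_algebra" where
  "cstar_completion A = star_quotient (cauchy_algebra A) (null_sequences A)"

definition completion_embed :: "'a star_algebra \<Rightarrow> 'a \<Rightarrow> (nat \<Rightarrow> 'a) set" where
  "completion_embed A x = null_sequences A +>\<^bsub>cauchy_algebra A\<^esub> (\<lambda>n. x)"

text \<open>The continuous extension of a bounded linear map: the limit of \<open>s\<close> goes to the
  limit of \<open>f \<circ> s\<close>.\<close>

definition completion_extend ::
  "'a star_algebra \<Rightarrow> ('a \<Rightarrow> 'a) \<Rightarrow> (nat \<Rightarrow> 'a) set \<Rightarrow> (nat \<Rightarrow> 'a) set" where
  "completion_extend A f = induced_map (cauchy_algebra A) (null_sequences A) (\<lambda>s n. f (s n))"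

text \<open>A quasi-basis \<open>{(u i, u i\<^sup>*) | i \<in> I}\<close> for a map \<open>\<Gamma>\<close> from \<open>B\<close> to the subalgebra with
  underlying set \<open>A\<close>. The notion is used for conditional expectations, but linearity and
  positivity of \<open>\<Gamma>\<close> do not enter the defining identities.\<close>

definition quasi_basis ::
  "'a star_algebra \<Rightarrow> 'a set \<Rightarrow> ('a \<Rightarrow> 'a) \<Rightarrow> 'i set \<Rightarrow> ('i \<Rightarrow> 'a) \<Rightarrow> bool" where
  "quasi_basis B A \<Gamma> I u \<longleftrightarrow>
    \<Gamma> \<in> carrier B \<rightarrow> A \<and> finite I \<and> u \<in> I \<rightarrow> carrier B \<and>
    (\<forall>a\<in>carrier B.
       (\<Oplus>\<^bsub>B\<^esub>i\<in>I. u i \<otimes>\<^bsub>B\<^esub> \<Gamma> (adj B (u i) \<otimes>\<^bsub>B\<^esub> a)) = a \<and>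
       (\<Oplus>\<^bsub>B\<^esub>i\<in>I. \<Gamma> (a \<otimes>\<^bsub>B\<^esub> u i) \<otimes>\<^bsub>B\<^esub> adj B (u i)) = a)"


section \<open>The free *-algebra on the generators\<close>

text \<open>\<open>Delta g x\<close> and \<open>Rho h l\<close> stand for \<open>\<delta>\<^sub>g(x)\<close> and \<open>\<rho>\<^sub>h(l)\<close>.\<close>

datatype 'g gen = Delta 'g int | Rho 'g rat

definition half_ints :: "rat set" where
  "half_ints = range (\<lambda>m::int. of_int m + 1/2)"

definition gens :: "('g, 'm) monoid_scheme \<Rightarrow> 'g set \<Rightarrow> 'g gen set" where
  "gens G H = {Delta g x |g x. g \<in> carrier G} \<union> {Rho h l |h l. h \<in> H \<and> l \<in> half_ints}"

text \<open>With concatenation as addition, lists are the free monoid, and \<open>'g gen list \<Rightarrow>\<^sub>0 complex\<close>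
  with its convolution product is the free complex algebra.\<close>

instantiation list :: (type) monoid_add
begin

definition zero_list :: "'a list" where "zero_list = []"

definition plus_list :: "'a list \<Rightarrow> 'a list \<Rightarrow> 'a list" where "plus_list xs ys = xs @ ys"

instance by standard (simp_all add: zero_list_def plus_list_def)

end

type_synonym 'g free = "'g gen list \<Rightarrow>\<^sub>0 complex"

abbreviation free_word :: "'g gen list \<Rightarrow> 'g free" where
  "free_word w \<equiv> Poly_Mapping.single w 1"

definition free_scale :: "complex \<Rightarrow> 'g free \<Rightarrow> 'g free" where
  "free_scale c p = Poly_Mapping.single [] c * p"

definition linear_extend :: "('g gen list \<Rightarrow> 'g free) \<Rightarrow> 'g free \<Rightarrow> 'g free" where
  "linear_extend f p = (\<Sum>w\<in>Poly_Mapping.keys p. free_scale (Poly_Mapping.lookup p w) (f w))"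

fun gen_adj :: "('g, 'm) monoid_scheme \<Rightarrow> 'g gen \<Rightarrow> 'g gen" where
  "gen_adj G (Delta g x) = Delta g x"
| "gen_adj G (Rho h l) = Rho (inv\<^bsub>G\<^esub> h) l"

definition free_adj :: "('g, 'm) monoid_scheme \<Rightarrow> 'g free \<Rightarrow> 'g free" where
  "free_adj G p = (\<Sum>w\<in>Poly_Mapping.keys p.
     Poly_Mapping.single (rev (map (gen_adj G) w)) (cnj (Poly_Mapping.lookup p w)))"

definition free_algebra :: "('g, 'm) monoid_scheme \<Rightarrow> 'g set \<Rightarrow> 'g free star_algebra" where
  "free_algebra G H =
    \<lparr>carrier = {p. Poly_Mapping.keys p \<subseteq> lists (gens G H)},
     mult = (*), one = 1, zero = 0, add = (+), smult = free_scale, adj = free_adj G\<rparr>"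


section \<open>The local algebra and the field algebra\<close>

abbreviation fdelta :: "'g \<Rightarrow> int \<Rightarrow> 'g free" where
  "fdelta g x \<equiv> free_word [Delta g x]"

abbreviation frho :: "'g \<Rightarrow> rat \<Rightarrow> 'g free" where
  "frho h l \<equiv> free_word [Rho h l]"

definition relators :: "('g, 'm) monoid_scheme \<Rightarrow> 'g set \<Rightarrow> 'g free set" where
  "relators G H =
     {(\<Sum>g\<in>carrier G. fdelta g x) - 1 |x. True}
   \<union> {frho \<one>\<^bsub>G\<^esub> l - 1 |l. l \<in> half_ints}
   \<union> {fdelta g1 x * fdelta g2 x - (if g1 = g2 then fdelta g1 x else 0) |g1 g2 x.
        g1 \<in> carrier G \<and> g2 \<in> carrier G}
   \<union> {frho h1 l * frho h2 l - frho (h1 \<otimes>\<^bsub>G\<^esub> h2) l |h1 h2 l.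
        h1 \<in> H \<and> h2 \<in> H \<and> l \<in> half_ints}
   \<union> {fdelta g1 x * fdelta g2 x' - fdelta g2 x' * fdelta g1 x |g1 g2 x x'.
        g1 \<in> carrier G \<and> g2 \<in> carrier G}
   \<union> {frho h l * fdelta g x - fdelta (h \<otimes>\<^bsub>G\<^esub> g) x * frho h l |h g l x.
        h \<in> H \<and> g \<in> carrier G \<and> l \<in> half_ints \<and> l < of_int x}
   \<union> {frho h l * fdelta g x - fdelta g x * frho h l |h g l x.
        h \<in> H \<and> g \<in> carrier G \<and> l \<in> half_ints \<and> l > of_int x}
   \<union> {frho h1 l * frho h2 l' - frho h2 l' * frho (inv\<^bsub>G\<^esub> h2 \<otimes>\<^bsub>G\<^esub> h1 \<otimes>\<^bsub>G\<^esub> h2) l |h1 h2 l l'.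
        h1 \<in> H \<and> h2 \<in> H \<and> l \<in> half_ints \<and> l' \<in> half_ints \<and> l > l'}"

definition relation_ideal :: "('g, 'm) monoid_scheme \<Rightarrow> 'g set \<Rightarrow> 'g free set" where
  "relation_ideal G H = Idl\<^bsub>free_algebra G H\<^esub> (relators G H)"

definition local_algebra :: "('g, 'm) monoid_scheme \<Rightarrow> 'g set \<Rightarrow> 'g free set star_algebra" where
  "local_algebra G H = star_quotient (free_algebra G H) (relation_ideal G H)"

type_synonym 'g field_elem = "(nat \<Rightarrow> 'g free set) set"

definition field_algebra :: "('g, 'm) monoid_scheme \<Rightarrow> 'g set \<Rightarrow> 'g field_elem star_algebra" where
  "field_algebra G H = cstar_completion (local_algebra G H)"

definition field_of_free :: "('g, 'm) monoid_scheme \<Rightarrow> 'g set \<Rightarrow> 'g free \<Rightarrow> 'g field_elem" where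
  "field_of_free G H p =
     completion_embed (local_algebra G H) (relation_ideal G H +>\<^bsub>free_algebra G H\<^esub> p)"

definition delta :: "('g, 'm) monoid_scheme \<Rightarrow> 'g set \<Rightarrow> 'g \<Rightarrow> int \<Rightarrow> 'g field_elem" where
  "delta G H g x = field_of_free G H (fdelta g x)"

definition rho :: "('g, 'm) monoid_scheme \<Rightarrow> 'g set \<Rightarrow> 'g \<Rightarrow> rat \<Rightarrow> 'g field_elem" where
  "rho G H h l = field_of_free G H (frho h l)"


section \<open>The action of the double\<close>

text \<open>An element of \<open>D(H;G)\<close> is represented by its coefficient function with respect to the
  basis \<open>(h,g)\<close>, \<open>h \<in> H\<close>, \<open>g \<in> G\<close>.\<close>

type_synonym 'g double = "'g \<times> 'g \<Rightarrow> complex"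

definition double_basis :: "'g \<Rightarrow> 'g \<Rightarrow> 'g double" where
  "double_basis h g = (\<lambda>p. if p = (h, g) then 1 else 0)"

definition z_double :: "('g, 'm) monoid_scheme \<Rightarrow> 'g double" where
  "z_double G = (\<lambda>p. 1 / of_nat (order G) * (\<Sum>g\<in>carrier G. double_basis \<one>\<^bsub>G\<^esub> g p))"

fun gen_act :: "('g, 'm) monoid_scheme \<Rightarrow> 'g \<Rightarrow> 'g \<Rightarrow> 'g gen \<Rightarrow> 'g free" where
  "gen_act G h g (Delta f x) = (if h = \<one>\<^bsub>G\<^esub> then fdelta (g \<otimes>\<^bsub>G\<^esub> f) x else 0)"
| "gen_act G h g (Rho t l) = (if h = g \<otimes>\<^bsub>G\<^esub> t \<otimes>\<^bsub>G\<^esub> inv\<^bsub>G\<^esub> g then frho h l else 0)"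

text \<open>The action of \<open>(h,g)\<close> on a word: on the empty word it is given by the counit
  \<open>\<epsilon>(h,g) = \<delta>\<^sub>h\<^sub>,\<^sub>e\<close>, on a product by the coproduct \<open>\<Delta>(h,g) = \<Sum>\<^sub>t (t,g) \<otimes> (t\<^sup>-\<^sup>1h,g)\<close>.\<close>

primrec word_act ::
  "('g, 'm) monoid_scheme \<Rightarrow> 'g set \<Rightarrow> 'g gen list \<Rightarrow> 'g \<Rightarrow> 'g \<Rightarrow> 'g free" where
  "word_act G H [] h g = (if h = \<one>\<^bsub>G\<^esub> then 1 else 0)"
| "word_act G H (s # w) h g =
     (\<Sum>t\<in>H. gen_act G t g s * word_act G H w (inv\<^bsub>G\<^esub> t \<otimes>\<^bsub>G\<^esub> h) g)"

definition free_act ::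
  "('g, 'm) monoid_scheme \<Rightarrow> 'g set \<Rightarrow> 'g double \<Rightarrow> 'g free \<Rightarrow> 'g free" where
  "free_act G H a p = (\<Sum>h\<in>H. \<Sum>g\<in>carrier G.
     free_scale (a (h, g)) (linear_extend (\<lambda>w. word_act G H w h g) p))"

definition local_act ::
  "('g, 'm) monoid_scheme \<Rightarrow> 'g set \<Rightarrow> 'g double \<Rightarrow> 'g free set \<Rightarrow> 'g free set" where
  "local_act G H a = induced_map (free_algebra G H) (relation_ideal G H) (free_act G H a)"

definition field_act ::
  "('g, 'm) monoid_scheme \<Rightarrow> 'g set \<Rightarrow> 'g double \<Rightarrow> 'g field_elem \<Rightarrow> 'g field_elem" where
  "field_act G H a = completion_extend (local_algebra G H) (local_act G H a)"

definition observable_algebra :: "('g, 'm) monoid_scheme \<Rightarrow> 'g set \<Rightarrow> 'g field_elem set" where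
  "observable_algebra G H =
     {F \<in> carrier (field_algebra G H). field_act G H (z_double G) F = F}"

end

theory Submission
  imports Defs
begin

text \<open>On words, \<open>z\<^sub>H\<close> is \<open>1/|G|\<close> times the sum over \<open>g \<in> G\<close> of \<open>\<alpha>\<^sub>g \<circ> E\<close>, where \<open>\<alpha>\<^sub>g\<close> is
  the *-automorphism given by the group-like element \<open>\<Sum>\<^sub>h (h,g)\<close> and \<open>E\<close> projects onto degree \<open>e\<close> for
  the grading of the algebra by \<open>H\<close> with \<open>\<delta>\<^sub>f(x)\<close> of degree \<open>e\<close> and \<open>\<rho>\<^sub>t(l)\<close> of degree \<open>t\<close>.
  If \<open>F\<close> has degree \<open>h\<close> and \<open>x\<close> lies to the right of its support, then
  \<open>F \<delta>\<^sub>f(x) = \<delta>\<^sub>h\<^sub>f(x) F\<close>, so \<open>E F = \<Sum>\<^sub>f \<delta>\<^sub>f(x) F \<delta>\<^sub>f(x)\<close>. This formula shows both that \<open>E\<close> respects the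
  relations and that it is bounded; the \<open>\<alpha>\<^sub>g\<close> are isometric because they permute the C*-seminorms.
  Hence \<open>z\<^sub>H\<close> acts on Cauchy sequences termwise, and the quasi-basis identities need to be checked
  only for a word \<open>F\<close> of degree \<open>h\<close>. There only one \<open>y\<close> (namely \<open>h\<close> or its inverse) contributes to the
  sum over \<open>H\<close>, the product \<open>\<delta>\<^sub>x(k) \<delta>\<^sub>g\<^sub>x(k)\<close> removes all \<open>g \<noteq> e\<close>, and the two \<open>\<rho>\<close> factors cancel.\<close>

section \<open>Star rings, their quotients and completions\<close>

text \<open>A fragment of the axioms of a complex *-algebra: just enough to be inherited by quotients
  and to support the completion.\<close>

locale star_ring = ring A for A :: "'a star_algebra" (structure) +
  assumes smult_closed [simp]: "x \<in> carrier A \<Longrightarrow> c \<odot> x \<in> carrier A"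
    and smult_add: "\<lbrakk>x \<in> carrier A; y \<in> carrier A\<rbrakk> \<Longrightarrow> c \<odot> (x \<oplus> y) = c \<odot> x \<oplus> c \<odot> y"
    and smult_mult_left: "\<lbrakk>x \<in> carrier A; y \<in> carrier A\<rbrakk> \<Longrightarrow> (c \<odot> x) \<otimes> y = c \<odot> (x \<otimes> y)"
    and smult_mult_right: "\<lbrakk>x \<in> carrier A; y \<in> carrier A\<rbrakk> \<Longrightarrow> x \<otimes> (c \<odot> y) = c \<odot> (x \<otimes> y)"
    and smult_minus_one: "x \<in> carrier A \<Longrightarrow> (- 1) \<odot> x = \<ominus> x"
    and adj_closed [simp]: "x \<in> carrier A \<Longrightarrow> adj A x \<in> carrier A"
    and adj_add: "\<lbrakk>x \<in> carrier A; y \<in> carrier A\<rbrakk> \<Longrightarrow> adj A (x \<oplus> y) = adj A x \<oplus> adj A y"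
    and adj_mult: "\<lbrakk>x \<in> carrier A; y \<in> carrier A\<rbrakk> \<Longrightarrow> adj A (x \<otimes> y) = adj A y \<otimes> adj A x"
    and adj_adj: "x \<in> carrier A \<Longrightarrow> adj A (adj A x) = x"
begin

lemma smult_minus:
  assumes "x \<in> carrier A" shows "c \<odot> (\<ominus> x) = \<ominus> (c \<odot> x)"
proof -
  \<comment> \<open>An element equal to its own double is zero, so additivity of scaling alone fixes
    its value at zero.\<close>
  have "c \<odot> \<zero> = c \<odot> \<zero> \<oplus> c \<odot> \<zero>"
    by (metis smult_add l_zero zero_closed)
  hence z: "c \<odot> \<zero> = \<zero>"
    by (metis add.l_cancel_one' smult_closed zero_closed)
  have "c \<odot> (\<ominus> x) \<oplus> c \<odot> x = \<zero>"
    using assms smult_add[of "\<ominus> x" x c] z by (simp add: l_neg)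
  thus ?thesis using assms by (simp add: minus_equality)
qed

lemma adj_minus:
  assumes "x \<in> carrier A" shows "adj A (\<ominus> x) = \<ominus> (adj A x)"
proof -
  have "adj A \<zero> = adj A \<zero> \<oplus> adj A \<zero>"
    by (metis adj_add l_zero zero_closed)
  hence z: "adj A \<zero> = \<zero>"
    by (metis add.l_cancel_one' adj_closed zero_closed)
  have "adj A (\<ominus> x) \<oplus> adj A x = \<zero>"
    using assms adj_add[of "\<ominus> x" x] z by (simp add: l_neg)
  thus ?thesis using assms by (simp add: minus_equality)
qed

end

text \<open>The axioms are equations plus the existence of additive inverses, so they pass along any
  surjection commuting with the operations. Applied to the coset map, this makes quotients star
  rings.\<close>

lemma star_ring_surj_image:
  fixes A :: "'a star_algebra" and B :: "'b star_algebra"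
  assumes "star_ring A"
    and carr: "carrier B = f ` carrier A"
    and add: "\<And>x y. \<lbrakk>x \<in> carrier A; y \<in> carrier A\<rbrakk> \<Longrightarrow> f x \<oplus>\<^bsub>B\<^esub> f y = f (x \<oplus>\<^bsub>A\<^esub> y)"
    and mul: "\<And>x y. \<lbrakk>x \<in> carrier A; y \<in> carrier A\<rbrakk> \<Longrightarrow> f x \<otimes>\<^bsub>B\<^esub> f y = f (x \<otimes>\<^bsub>A\<^esub> y)"
    and sm: "\<And>c x. x \<in> carrier A \<Longrightarrow> c \<odot>\<^bsub>B\<^esub> f x = f (c \<odot>\<^bsub>A\<^esub> x)"
    and ad: "\<And>x. x \<in> carrier A \<Longrightarrow> adj B (f x) = f (adj A x)"
    and zero: "\<zero>\<^bsub>B\<^esub> = f \<zero>\<^bsub>A\<^esub>" and one: "\<one>\<^bsub>B\<^esub> = f \<one>\<^bsub>A\<^esub>"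
  shows "star_ring B"
proof -
  interpret A: star_ring A by fact
  have "abelian_group B"
  proof (rule abelian_groupI)
    fix x assume "x \<in> carrier B"
    then obtain a where a: "a \<in> carrier A" "x = f a" by (auto simp: carr)
    show "\<exists>y\<in>carrier B. y \<oplus>\<^bsub>B\<^esub> x = \<zero>\<^bsub>B\<^esub>"
      using a by (intro bexI[of _ "f (\<ominus>\<^bsub>A\<^esub> a)"]) (auto simp: carr add zero A.l_neg)
  qed (auto simp: carr add zero A.a_ac)
  moreover have "Group.monoid B"
    by (rule monoidI) (auto simp: carr mul one A.m_assoc)
  ultimately interpret B: ring B
    by (rule ringI) (auto simp: carr add mul A.l_distr A.r_distr)
  have "\<ominus>\<^bsub>B\<^esub> (f x) = f (\<ominus>\<^bsub>A\<^esub> x)" if "x \<in> carrier A" for x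
    using that by (intro B.minus_equality) (auto simp: carr add zero A.l_neg)
  then show ?thesis
    by unfold_locales (auto simp: carr add mul sm ad A.smult_add A.smult_mult_left
        A.smult_mult_right A.adj_add A.adj_mult A.adj_adj A.smult_minus_one)
qed

text \<open>The image of a coset under \<open>f\<close> lies in the coset of \<open>f a\<close> but
  may be only a part of it; adding \<open>H\<close> once more, as \<open>induced_map\<close> does,
  fills it up.\<close>

lemma (in abelian_subgroup) induced_map_coset:
  assumes f: "f \<in> carrier G \<rightarrow> carrier G"
    and f_add: "\<And>x y. \<lbrakk>x \<in> carrier G; y \<in> carrier G\<rbrakk> \<Longrightarrow> f (x \<oplus> y) = f x \<oplus> f y"
    and f_H: "f ` H \<subseteq> H" and a: "a \<in> carrier G"
  shows "induced_map G H f (H +> a) = H +> f a"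
proof -
  have sub: "f b \<in> H +> f a" if b: "b \<in> H +> a" for b
  proof -
    from b obtain h where h: "h \<in> H" "b = h \<oplus> a"
      by (auto simp: a_r_coset_def')
    then have "f b = f h \<oplus> f a" using f_add a a_subset by auto
    then show ?thesis using h f_H by (auto simp: a_r_coset_def')
  qed
  have fa: "f a \<in> carrier G" using f a by auto
  have absorb: "set_add G H (H +> f a) = H +> f a"
    using a_setmult_rcos_assoc[of H H "f a"] fa a_subset subgroup_add_id[OF a_subgroup] by simp
  have "H +> f a \<subseteq> set_add G H (f ` (H +> a))"
  proof
    fix b assume "b \<in> H +> f a"
    then obtain h where "h \<in> H" "b = h \<oplus> f a" by (auto simp: a_r_coset_def')
    moreover have "f a \<in> f ` (H +> a)" using a a_rcos_self by simp
    ultimately show "b \<in> set_add G H (f ` (H +> a))" by (force simp: set_add_def')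
  qed
  moreover have "set_add G H (f ` (H +> a)) \<subseteq> set_add G H (H +> f a)"
    using sub by (auto simp: set_add_def')
  ultimately show ?thesis by (simp add: induced_map_def absorb)
qed

section \<open>Quotients by star ideals\<close>

locale star_ideal = star_ring A + ideal I A for I and A :: "'a star_algebra" (structure) +
  assumes smult_ideal: "x \<in> I \<Longrightarrow> c \<odot> x \<in> I"
    and adj_ideal: "x \<in> I \<Longrightarrow> adj A x \<in> I"
begin

lemma carrier_quotient: "carrier (star_quotient A I) = (+>) I ` carrier A"
  by (auto simp: star_quotient_def FactRing_def A_RCOSETS_def')

lemma quotient_zero: "\<zero>\<^bsub>star_quotient A I\<^esub> = I +> \<zero>"
  using ring_hom_zero[OF rcos_ring_hom ring_axioms quotient_is_ring]
  by (simp add: star_quotient_def)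

lemma quotient_one: "\<one>\<^bsub>star_quotient A I\<^esub> = I +> \<one>"
  using ring_hom_one[OF rcos_ring_hom] by (simp add: star_quotient_def)

lemma quotient_add:
  "\<lbrakk>x \<in> carrier A; y \<in> carrier A\<rbrakk> \<Longrightarrow> (I +> x) \<oplus>\<^bsub>star_quotient A I\<^esub> (I +> y) = I +> (x \<oplus> y)"
  using ring_hom_add[OF rcos_ring_hom, of x y] by (simp add: star_quotient_def)

lemma quotient_mult:
  "\<lbrakk>x \<in> carrier A; y \<in> carrier A\<rbrakk> \<Longrightarrow> (I +> x) \<otimes>\<^bsub>star_quotient A I\<^esub> (I +> y) = I +> (x \<otimes> y)"
  using ring_hom_mult[OF rcos_ring_hom, of x y] by (simp add: star_quotient_def)

lemma quotient_smult:
  "x \<in> carrier A \<Longrightarrow> c \<odot>\<^bsub>star_quotient A I\<^esub> (I +> x) = I +> (c \<odot> x)"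
  by (simp add: star_quotient_def induced_map_coset smult_add smult_ideal image_subset_iff)

lemma quotient_adj:
  "x \<in> carrier A \<Longrightarrow> adj (star_quotient A I) (I +> x) = I +> (adj A x)"
  by (simp add: star_quotient_def induced_map_coset adj_add adj_ideal image_subset_iff)

lemma star_ring_quotient: "star_ring (star_quotient A I)"
  by (rule star_ring_surj_image[OF star_ring_axioms])
    (auto simp: carrier_quotient quotient_zero quotient_one quotient_add quotient_mult
      quotient_smult quotient_adj)

lemma coset_eq_iff:
  "\<lbrakk>x \<in> carrier A; y \<in> carrier A\<rbrakk> \<Longrightarrow> I +> x = I +> y \<longleftrightarrow> x \<ominus> y \<in> I"
  using quotient_eq_iff_same_a_r_cos[OF is_ideal, of x y] by simp

end

section \<open>The largest C*-seminorm\<close>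

locale bounded_star_ring = star_ring +
  assumes bdd: "x \<in> carrier A \<Longrightarrow> bdd_above ((\<lambda>p. p x) ` Collect (cstar_seminorm A))"
begin

abbreviation "nu \<equiv> env_norm A"

text \<open>The zero seminorm keeps the index set of the supremum nonempty, as
  \<open>cSUP_least\<close> requires, and gives nonnegativity of \<open>nu\<close>.\<close>

lemma cstar_seminorm_zero: "cstar_seminorm A (\<lambda>x. 0)"
  by (simp add: cstar_seminorm_def)

text \<open>The assumption \<open>bdd\<close> enters here: a supremum of reals is an upper bound
  only for a bounded family.\<close>

lemma seminorm_le_env_norm: "\<lbrakk>cstar_seminorm A p; x \<in> carrier A\<rbrakk> \<Longrightarrow> p x \<le> nu x"
  unfolding env_norm_def by (rule cSUP_upper) (auto intro: bdd)

lemma env_norm_le: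
  assumes "\<And>p. cstar_seminorm A p \<Longrightarrow> p x \<le> c" shows "nu x \<le> c"
  unfolding env_norm_def using assms cstar_seminorm_zero by (intro cSUP_least) auto

lemma env_norm_nonneg: "x \<in> carrier A \<Longrightarrow> 0 \<le> nu x"
  using seminorm_le_env_norm[OF cstar_seminorm_zero] .

lemma env_norm_triangle:
  assumes "x \<in> carrier A" "y \<in> carrier A" shows "nu (x \<oplus> y) \<le> nu x + nu y"
proof (rule env_norm_le)
  fix p assume p: "cstar_seminorm A p"
  then have "p (x \<oplus> y) \<le> p x + p y" using assms by (auto simp: cstar_seminorm_def)
  also have "\<dots> \<le> nu x + nu y" using seminorm_le_env_norm[OF p] assms by (intro add_mono)
  finally show "p (x \<oplus> y) \<le> nu x + nu y" .
qed

lemma env_norm_mult: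
  assumes "x \<in> carrier A" "y \<in> carrier A" shows "nu (x \<otimes> y) \<le> nu x * nu y"
proof (rule env_norm_le)
  fix p assume p: "cstar_seminorm A p"
  then have "p (x \<otimes> y) \<le> p x * p y" "0 \<le> p x" "0 \<le> p y"
    using assms by (auto simp: cstar_seminorm_def)
  moreover have "p x \<le> nu x" "p y \<le> nu y" using seminorm_le_env_norm[OF p] assms by auto
  ultimately show "p (x \<otimes> y) \<le> nu x * nu y" by (meson mult_mono order_trans)
qed

lemma env_norm_smult_le:
  assumes "x \<in> carrier A" shows "nu (c \<odot> x) \<le> cmod c * nu x"
proof (rule env_norm_le)
  fix p assume p: "cstar_seminorm A p"
  then have "p (c \<odot> x) = cmod c * p x"
    using assms by (auto simp: cstar_seminorm_def)
  with seminorm_le_env_norm[OF p assms] show "p (c \<odot> x) \<le> cmod c * nu x"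
    by (simp add: mult_left_mono)
qed

lemma env_norm_minus:
  assumes "x \<in> carrier A" shows "nu (\<ominus> x) = nu x"
  using env_norm_smult_le[of x "-1"] env_norm_smult_le[of "\<ominus> x" "-1"] assms
  by (simp add: smult_minus_one)

text \<open>The C*-identity bounds the square of \<open>p (adj A x)\<close> by
  \<open>p x * p (adj A x)\<close>, and one factor can be cancelled.\<close>

lemma env_norm_adj_le:
  assumes x: "x \<in> carrier A" shows "nu (adj A x) \<le> nu x"
proof (rule env_norm_le)
  fix p assume p: "cstar_seminorm A p"
  then have "(p (adj A x))\<^sup>2 = p (adj A (adj A x) \<otimes> adj A x)"
    using x by (auto simp: cstar_seminorm_def)
  also have "\<dots> \<le> p x * p (adj A x)" using p x by (auto simp: cstar_seminorm_def adj_adj)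
  finally have "p (adj A x) * p (adj A x) \<le> p x * p (adj A x)" by (simp add: power2_eq_square)
  moreover have "0 \<le> p (adj A x)" "0 \<le> p x" using p x by (auto simp: cstar_seminorm_def)
  \<comment> \<open>If \<open>p (adj A x)\<close> is zero there is nothing to cancel, but then the
    claim is just nonnegativity of \<open>p x\<close>.\<close>
  ultimately have "p (adj A x) \<le> p x"
    by (metis mult_le_cancel_right not_le order.order_iff_strict)
  with seminorm_le_env_norm[OF p x] show "p (adj A x) \<le> nu x" by simp
qed

lemma env_norm_zero: "nu \<zero> = 0"
proof -
  have "nu (0 \<odot> \<zero>) \<le> 0" using env_norm_smult_le[of \<zero> 0] by simp
  moreover have "0 \<odot> \<zero> = \<zero>"
  proof -
    have "0 \<odot> \<zero> = 0 \<odot> \<zero> \<oplus> 0 \<odot> \<zero>"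
      by (metis smult_add l_zero zero_closed)
    thus ?thesis by (metis add.l_cancel_one' smult_closed zero_closed)
  qed
  ultimately show ?thesis using env_norm_nonneg[of \<zero>] by simp
qed

section \<open>Cauchy sequences\<close>

abbreviation "C \<equiv> cauchy_algebra A"

lemma in_cauchy_iff: "s \<in> carrier C \<longleftrightarrow> (\<forall>n. s n \<in> carrier A) \<and>
    (\<forall>\<epsilon>>0. \<exists>M. \<forall>m\<ge>M. \<forall>n\<ge>M. nu (s m \<ominus> s n) < \<epsilon>)"
  by (simp add: cauchy_algebra_def)

lemma cauchyD: "s \<in> carrier C \<Longrightarrow> s n \<in> carrier A"
  by (simp add: in_cauchy_iff)

lemma const_cauchy: "x \<in> carrier A \<Longrightarrow> (\<lambda>n. x) \<in> carrier C"
  by (simp add: in_cauchy_iff env_norm_zero r_neg minus_eq)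

lemma cauchy_bound:
  assumes "s \<in> carrier C" shows "\<exists>B>0. \<forall>n. nu (s n) \<le> B"
proof -
  from assms obtain M where M: "\<And>m n. m \<ge> M \<Longrightarrow> n \<ge> M \<Longrightarrow> nu (s m \<ominus> s n) < 1"
    unfolding in_cauchy_iff by (meson zero_less_one)
  have s: "s n \<in> carrier A" for n using assms by (rule cauchyD)
  \<comment> \<open>The sum bounds every term up to \<open>M\<close>, in particular
    \<open>s M\<close>, from which all later terms differ by less than 1.\<close>
  have "nu (s n) \<le> 1 + (\<Sum>i\<le>M. nu (s i))" for n
  proof (cases "n \<le> M")
    case True
    then have "nu (s n) \<le> (\<Sum>i\<le>M. nu (s i))"
      using env_norm_nonneg[OF s] by (intro member_le_sum) auto
    then show ?thesis by simp
  next
    case False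
    have "s n = (s n \<ominus> s M) \<oplus> s M" using s by (simp add: minus_eq a_assoc l_neg)
    then have "nu (s n) \<le> nu (s n \<ominus> s M) + nu (s M)"
      using env_norm_triangle[of "s n \<ominus> s M" "s M"] s by simp
    moreover have "nu (s M) \<le> (\<Sum>i\<le>M. nu (s i))"
      using env_norm_nonneg[OF s] by (intro member_le_sum) auto
    moreover have "nu (s n \<ominus> s M) < 1" using M False by simp
    ultimately show ?thesis by linarith
  qed
  moreover have "0 < 1 + (\<Sum>i\<le>M. nu (s i))"
    using env_norm_nonneg[OF s] by (simp add: add_pos_nonneg sum_nonneg)
  ultimately show ?thesis by blast
qed

text \<open>One Lipschitz criterion in two sequences serves all operations: addition and
  multiplication use both arguments, unary maps take the same sequence twice.\<close>

lemma cauchy_map2: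
  assumes s: "s \<in> carrier C" and t: "t \<in> carrier C" and B: "0 \<le> B"
    and closed: "\<And>n. f n \<in> carrier A"
    and le: "\<And>m n. nu (f m \<ominus> f n) \<le> B * nu (s m \<ominus> s n) + B * nu (t m \<ominus> t n)"
  shows "f \<in> carrier C"
  unfolding in_cauchy_iff
proof (intro conjI allI impI closed)
  fix e :: real assume e: "0 < e"
  \<comment> \<open>The extra 1 keeps the divisor positive for \<open>B = 0\<close> and makes the
    final estimate strict.\<close>
  define d where "d = e / (2 * B + 1)"
  have d: "0 < d" using e B by (simp add: d_def)
  obtain M where M: "\<And>m n. m \<ge> M \<Longrightarrow> n \<ge> M \<Longrightarrow> nu (s m \<ominus> s n) < d"
    using s d unfolding in_cauchy_iff by meson
  obtain N where N: "\<And>m n. m \<ge> N \<Longrightarrow> n \<ge> N \<Longrightarrow> nu (t m \<ominus> t n) < d"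
    using t d unfolding in_cauchy_iff by meson
  have "nu (f m \<ominus> f n) < e" if "m \<ge> max M N" "n \<ge> max M N" for m n
  proof -
    have "nu (f m \<ominus> f n) \<le> B * nu (s m \<ominus> s n) + B * nu (t m \<ominus> t n)" by (rule le)
    also have "\<dots> \<le> B * d + B * d"
      using M[of m n] N[of m n] that B by (intro add_mono mult_left_mono) auto
    also have "\<dots> < (2 * B + 1) * d" using d by (simp add: algebra_simps)
    also have "\<dots> = e" using B by (simp add: d_def)
    finally show ?thesis .
  qed
  then show "\<exists>M. \<forall>m\<ge>M. \<forall>n\<ge>M. nu (f m \<ominus> f n) < e" by blast
qed

lemma cauchy_map:
  assumes s: "s \<in> carrier C" and B: "0 \<le> B"
    and closed: "\<And>x. x \<in> carrier A \<Longrightarrow> f x \<in> carrier A"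
    and diff: "\<And>x y. \<lbrakk>x \<in> carrier A; y \<in> carrier A\<rbrakk> \<Longrightarrow> f x \<ominus> f y = f (x \<ominus> y)"
    and le: "\<And>x. x \<in> carrier A \<Longrightarrow> nu (f x) \<le> B * nu x"
  shows "(\<lambda>n. f (s n)) \<in> carrier C"
proof (rule cauchy_map2[OF s s B])
  fix m n
  note sc = cauchyD[OF s]
  have "nu (f (s m) \<ominus> f (s n)) \<le> B * nu (s m \<ominus> s n)"
    using sc by (simp add: diff le)
  moreover have "0 \<le> B * nu (s m \<ominus> s n)" using B env_norm_nonneg sc by simp
  ultimately show "nu (f (s m) \<ominus> f (s n)) \<le> B * nu (s m \<ominus> s n) + B * nu (s m \<ominus> s n)" by simp
qed (simp add: closed cauchyD[OF s])

lemma cauchy_smult: "s \<in> carrier C \<Longrightarrow> (\<lambda>n. c \<odot> s n) \<in> carrier C"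
  by (erule cauchy_map[where B = "cmod c"])
    (auto simp: env_norm_smult_le minus_eq smult_add smult_minus)

lemma cauchy_adj: "s \<in> carrier C \<Longrightarrow> (\<lambda>n. adj A (s n)) \<in> carrier C"
  by (erule cauchy_map[where B = 1])
    (auto simp: env_norm_adj_le minus_eq adj_add adj_minus)

lemma cauchy_add:
  assumes "s \<in> carrier C" "t \<in> carrier C" shows "(\<lambda>n. s n \<oplus> t n) \<in> carrier C"
proof (rule cauchy_map2[OF assms, of 1])
  fix m n
  note sc = assms[THEN cauchyD]
  have "(s m \<oplus> t m) \<ominus> (s n \<oplus> t n) = (s m \<ominus> s n) \<oplus> (t m \<ominus> t n)"
    using sc by (simp add: minus_eq minus_add a_ac)
  then show "nu ((s m \<oplus> t m) \<ominus> (s n \<oplus> t n)) \<le> 1 * nu (s m \<ominus> s n) + 1 * nu (t m \<ominus> t n)"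
    using env_norm_triangle sc by simp
qed (auto simp: assms[THEN cauchyD])

lemma cauchy_mult:
  assumes "s \<in> carrier C" "t \<in> carrier C" shows "(\<lambda>n. s n \<otimes> t n) \<in> carrier C"
proof -
  from cauchy_bound[OF assms(1)] cauchy_bound[OF assms(2)] obtain B1 B2 where
    B: "0 < B1" "0 < B2" "\<And>n. nu (s n) \<le> B1" "\<And>n. nu (t n) \<le> B2" by blast
  note sc = assms[THEN cauchyD]
  show ?thesis
  proof (rule cauchy_map2[OF assms, of "max B1 B2"])
    fix m n
    \<comment> \<open>The mixed term \<open>s n \<otimes> t m\<close> is inserted, so that each
      difference is multiplied by a term of a bounded sequence.\<close>
    have "(s m \<otimes> t m) \<ominus> (s n \<otimes> t n) = (s m \<ominus> s n) \<otimes> t m \<oplus> s n \<otimes> (t m \<ominus> t n)"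
      using sc by (simp add: minus_eq l_distr r_distr l_minus r_minus a_assoc)
        (simp add: a_assoc[symmetric] l_neg)
    then have "nu ((s m \<otimes> t m) \<ominus> (s n \<otimes> t n)) \<le>
        nu (s m \<ominus> s n) * nu (t m) + nu (s n) * nu (t m \<ominus> t n)"
      using env_norm_triangle[of "(s m \<ominus> s n) \<otimes> t m" "s n \<otimes> (t m \<ominus> t n)"]
        env_norm_mult[of "s m \<ominus> s n" "t m"] env_norm_mult[of "s n" "t m \<ominus> t n"] sc by simp
    also have "\<dots> \<le> nu (s m \<ominus> s n) * max B1 B2 + max B1 B2 * nu (t m \<ominus> t n)"
      using sc env_norm_nonneg B(3)[of n] B(4)[of m]
      by (intro add_mono mult_left_mono mult_right_mono) auto
    finally show "nu ((s m \<otimes> t m) \<ominus> (s n \<otimes> t n))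
        \<le> max B1 B2 * nu (s m \<ominus> s n) + max B1 B2 * nu (t m \<ominus> t n)"
      by (simp add: mult.commute)
  qed (use sc B in auto)
qed

lemma cauchy_simps [simp]:
  "\<zero>\<^bsub>C\<^esub> = (\<lambda>n. \<zero>)" "\<one>\<^bsub>C\<^esub> = (\<lambda>n. \<one>)"
  "s \<oplus>\<^bsub>C\<^esub> t = (\<lambda>n. s n \<oplus> t n)" "s \<otimes>\<^bsub>C\<^esub> t = (\<lambda>n. s n \<otimes> t n)"
  "c \<odot>\<^bsub>C\<^esub> s = (\<lambda>n. c \<odot> s n)" "adj C s = (\<lambda>n. adj A (s n))"
  by (simp_all add: cauchy_algebra_def)

lemma cauchy_minus: "s \<in> carrier C \<Longrightarrow> (\<lambda>n. \<ominus> s n) \<in> carrier C"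
  using cauchy_smult[of s "-1"] by (simp add: smult_minus_one cauchyD)

lemma star_ring_cauchy: "star_ring C"
proof -
  have "abelian_group C"
  proof (rule abelian_groupI)
    fix s assume s: "s \<in> carrier C"
    show "\<exists>t\<in>carrier C. t \<oplus>\<^bsub>C\<^esub> s = \<zero>\<^bsub>C\<^esub>"
      by (rule bexI[OF _ cauchy_minus[OF s]]) (simp add: l_neg cauchyD[OF s])
  qed (auto simp: cauchy_add const_cauchy cauchyD a_ac)
  moreover have "Group.monoid C"
    by (rule monoidI) (auto simp: cauchy_mult const_cauchy cauchyD m_assoc)
  ultimately interpret C: ring C
    by (rule ringI) (auto simp: cauchyD l_distr r_distr)
  have "\<ominus>\<^bsub>C\<^esub> s = (\<lambda>n. \<ominus> s n)" if "s \<in> carrier C" for s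
    using that by (intro C.minus_equality) (auto simp: cauchyD cauchy_minus l_neg)
  then show ?thesis
    by unfold_locales (auto simp: cauchyD cauchy_smult cauchy_adj smult_add smult_mult_left
        smult_mult_right adj_add adj_mult adj_adj smult_minus_one)
qed

section \<open>Null sequences and the extension of bounded maps\<close>

abbreviation "N \<equiv> null_sequences A"

lemma in_null_iff: "s \<in> N \<longleftrightarrow> s \<in> carrier C \<and> (\<lambda>n. nu (s n)) \<longlonglongrightarrow> 0"
  by (simp add: null_sequences_def)

lemma nullI:
  assumes "s \<in> carrier C" "t \<longlonglongrightarrow> 0" "\<And>n. nu (s n) \<le> t n" shows "s \<in> N"
  unfolding in_null_iff
  using tendsto_sandwich[of "\<lambda>n. 0" "\<lambda>n. nu (s n)" sequentially t 0] assms
  by (auto simp: env_norm_nonneg cauchyD)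

text \<open>A null sequence times a Cauchy sequence is null because Cauchy sequences are bounded;
  scaling and the adjoint multiply the norm at most by a constant.\<close>

lemma star_ideal_null: "star_ideal N C"
proof -
  interpret C: star_ring C by (rule star_ring_cauchy)
  have NC: "s \<in> carrier C" "(\<lambda>n. nu (s n)) \<longlonglongrightarrow> 0" if "s \<in> N" for s
    using that by (auto simp: in_null_iff)
  have inv: "\<ominus>\<^bsub>C\<^esub> s = (\<lambda>n. \<ominus> s n)" if "s \<in> carrier C" for s
    using that by (intro C.minus_equality) (auto simp: cauchyD cauchy_minus l_neg)
  have "additive_subgroup N C"
  proof (rule additive_subgroupI, rule subgroup.intro)
    show "N \<subseteq> carrier (add_monoid C)" using NC by auto
    show "\<one>\<^bsub>add_monoid C\<^esub> \<in> N" by (simp add: in_null_iff const_cauchy env_norm_zero)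
  next
    fix s t assume st: "s \<in> N" "t \<in> N"
    have "(\<lambda>n. s n \<oplus> t n) \<in> N"
    proof (rule nullI)
      show "(\<lambda>n. nu (s n) + nu (t n)) \<longlonglongrightarrow> 0"
        using tendsto_add[OF NC(2) NC(2), OF st] by simp
    qed (use st NC in \<open>auto simp: cauchy_add cauchyD env_norm_triangle\<close>)
    then show "s \<otimes>\<^bsub>add_monoid C\<^esub> t \<in> N" by simp
  next
    fix s assume s: "s \<in> N"
    then show "inv\<^bsub>add_monoid C\<^esub> s \<in> N"
      using inv[OF NC(1)[OF s], unfolded a_inv_def[of C]]
      by (simp add: in_null_iff cauchy_minus env_norm_minus cauchyD)
  qed
  then interpret additive_subgroup N C .
  show ?thesis
  proof unfold_locales
    fix a x assume a: "a \<in> N" and x: "x \<in> carrier C"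
    obtain B where B: "0 < B" "\<And>n. nu (x n) \<le> B" using cauchy_bound[OF x] by blast
    have lim: "(\<lambda>n. B * nu (a n)) \<longlonglongrightarrow> 0"
      using tendsto_mult_left[OF NC(2)[OF a], of B] by simp
    have c: "a n \<in> carrier A" "x n \<in> carrier A" for n
      using NC(1)[OF a] x cauchyD by auto
    note nn = env_norm_nonneg[OF c(1)]
    show "x \<otimes>\<^bsub>C\<^esub> a \<in> N" unfolding cauchy_simps
    proof (rule nullI[OF _ lim])
      fix n show "nu (x n \<otimes> a n) \<le> B * nu (a n)"
        using env_norm_mult[OF c(2) c(1)] mult_right_mono[OF B(2)[of n] nn] by (meson order_trans)
    qed (use a x NC cauchy_mult in auto)
    show "a \<otimes>\<^bsub>C\<^esub> x \<in> N" unfolding cauchy_simps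
    proof (rule nullI[OF _ lim])
      fix n show "nu (a n \<otimes> x n) \<le> B * nu (a n)"
        using env_norm_mult[OF c(1) c(2), of n n] mult_left_mono[OF B(2)[of n] nn[of n]]
        by (simp add: mult.commute)
    qed (use a x NC cauchy_mult in auto)
  next
    fix a c assume a: "a \<in> N"
    show "c \<odot>\<^bsub>C\<^esub> a \<in> N" unfolding cauchy_simps
    proof (rule nullI)
      show "(\<lambda>n. cmod c * nu (a n)) \<longlonglongrightarrow> 0"
        using tendsto_mult_left[OF NC(2)[OF a], of "cmod c"] by simp
    qed (use a NC in \<open>auto simp: cauchy_smult cauchyD env_norm_smult_le\<close>)
    show "adj C a \<in> N" unfolding cauchy_simps
      by (rule nullI[OF _ NC(2)[OF a]]) (use a NC in \<open>auto simp: cauchy_adj cauchyD env_norm_adj_le\<close>)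
  qed
qed

text \<open>The norm bound makes \<open>f\<close> preserve Cauchy sequences and null sequences, so
  its extension can be computed termwise on any representative.\<close>

lemma completion_extend_coset:
  assumes B: "0 \<le> B"
    and closed: "\<And>x. x \<in> carrier A \<Longrightarrow> f x \<in> carrier A"
    and add: "\<And>x y. \<lbrakk>x \<in> carrier A; y \<in> carrier A\<rbrakk> \<Longrightarrow> f (x \<oplus> y) = f x \<oplus> f y"
    and le: "\<And>x. x \<in> carrier A \<Longrightarrow> nu (f x) \<le> B * nu x"
    and s: "s \<in> carrier C"
  shows "(\<lambda>n. f (s n)) \<in> carrier C"
    and "completion_extend A f (N +>\<^bsub>C\<^esub> s) = N +>\<^bsub>C\<^esub> (\<lambda>n. f (s n))"
proof -
  have diff: "f x \<ominus> f y = f (x \<ominus> y)" if "x \<in> carrier A" "y \<in> carrier A" for x y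
  proof -
    have "f x = f (x \<ominus> y) \<oplus> f y"
      using that add[of "x \<ominus> y" y] by (simp add: minus_eq a_assoc l_neg)
    then show ?thesis
      using that closed by (simp add: minus_eq a_assoc r_neg)
  qed
  interpret star_ideal N C by (rule star_ideal_null)
  have *: "(\<lambda>n. f (s n)) \<in> carrier C" if "s \<in> carrier C" for s
    by (rule cauchy_map[OF that B closed diff le])
  from *[OF s] show "(\<lambda>n. f (s n)) \<in> carrier C" .
  show "completion_extend A f (N +>\<^bsub>C\<^esub> s) = N +>\<^bsub>C\<^esub> (\<lambda>n. f (s n))"
    unfolding completion_extend_def
  proof (rule induced_map_coset)
    show "(\<lambda>s n. f (s n)) ` N \<subseteq> N"
    proof (safe)
      fix s assume s: "s \<in> N"
      then have sc: "s \<in> carrier C" by (simp add: in_null_iff)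
      show "(\<lambda>n. f (s n)) \<in> N"
      proof (rule nullI[OF *[OF sc]])
        show "(\<lambda>n. B * nu (s n)) \<longlonglongrightarrow> 0"
          using s tendsto_mult_left[of "\<lambda>n. nu (s n)" 0 _ B] by (simp add: in_null_iff)
      qed (simp add: le cauchyD[OF sc])
    qed
  qed (use * s in \<open>auto simp: add cauchyD\<close>)
qed

end

section \<open>Linear maps on the free algebra\<close>

lemma lookup_free_scale [simp]: "Poly_Mapping.lookup (free_scale c p) w = c * Poly_Mapping.lookup p w"
proof -
  have "free_scale c p = Poly_Mapping.map ((*) c) p"
    by (simp add: free_scale_def mult_map_scale_conv_mult zero_list_def)
  then show ?thesis by (simp add: Poly_Mapping.map.rep_eq when_def)
qed

lemma free_scale_simps [simp]:
  "free_scale c 0 = 0" "free_scale 0 p = 0" "free_scale 1 p = p"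
  "free_scale c (free_scale d p) = free_scale (c * d) p"
  "free_scale c (Poly_Mapping.single w d) = Poly_Mapping.single w (c * d)"
  "free_scale (-1) p = - p"
  by (auto intro!: poly_mapping_eqI simp: lookup_single when_def simp del: single_uminus)

lemma free_scale_add: "free_scale c (p + q) = free_scale c p + free_scale c q"
  by (simp add: free_scale_def distrib_left)

lemma free_scale_diff: "free_scale c (p - q) = free_scale c p - free_scale c q"
  by (simp add: free_scale_def right_diff_distrib)

lemma free_scale_add_left: "free_scale (c + d) p = free_scale c p + free_scale d p"
  by (simp add: free_scale_def distrib_right single_add)

lemma free_scale_sum: "free_scale c (sum f S) = (\<Sum>i\<in>S. free_scale c (f i))"
  by (simp add: free_scale_def sum_distrib_left)

lemma free_sum_const: "(\<Sum>i\<in>S. p) = free_scale (of_nat (card S)) p"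
  by (induction S rule: infinite_finite_induct) (simp_all add: free_scale_add_left del: sum_constant)

lemma free_scale_mult_left: "free_scale c p * q = free_scale c (p * q)"
  by (simp add: free_scale_def mult.assoc)

lemma free_expand: "p = (\<Sum>w\<in>Poly_Mapping.keys p. free_scale (Poly_Mapping.lookup p w) (free_word w))"
proof (rule poly_mapping_eqI)
  fix v
  show "Poly_Mapping.lookup p v = Poly_Mapping.lookup
    (\<Sum>w\<in>Poly_Mapping.keys p. free_scale (Poly_Mapping.lookup p w) (free_word w)) v"
    by (simp add: lookup_sum lookup_single when_def in_keys_iff if_distrib[of "(*) c" for c])
qed

text \<open>Every element is the finite sum of its scaled words. The support condition is carried
  along so that in the \<open>add\<close> case both summands are known to lie over
  \<open>S\<close>.\<close>

lemma free_induct [consumes 1, case_names zero word add]: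
  assumes "Poly_Mapping.keys p \<subseteq> S" and zero: "P 0"
    and word: "\<And>c w. w \<in> S \<Longrightarrow> P (free_scale c (free_word w))"
    and add: "\<And>p q. \<lbrakk>Poly_Mapping.keys p \<subseteq> S; Poly_Mapping.keys q \<subseteq> S; P p; P q\<rbrakk> \<Longrightarrow> P (p + q)"
  shows "P p"
proof -
  define t where "t w = free_scale (Poly_Mapping.lookup p w) (free_word w)" for w
  have t: "Poly_Mapping.keys (t w) \<subseteq> S" "P (t w)" if "w \<in> S" for w
    using that word by (simp_all add: t_def)
  have "Poly_Mapping.keys (sum t W) \<subseteq> S \<and> P (sum t W)" if "finite W" "W \<subseteq> S" for W
    using that
  proof (induction W rule: finite_induct)
    case empty
    show ?case by (simp add: zero)
  next
    case (insert w W)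
    then have w: "w \<in> S" and IH: "Poly_Mapping.keys (sum t W) \<subseteq> S" "P (sum t W)" by auto
    have "Poly_Mapping.keys (t w + sum t W) \<subseteq> S"
      using keys_add[of "t w" "sum t W"] t(1)[OF w] IH(1) by blast
    moreover have "P (t w + sum t W)" by (rule add[OF t(1)[OF w] IH(1) t(2)[OF w] IH(2)])
    ultimately show ?case using insert.hyps by simp
  qed
  from this[OF finite_keys assms(1)] show ?thesis
    unfolding t_def free_expand[of p, symmetric] ..
qed

lemma free_word_append: "free_word v * free_word w = free_word (v @ w)"
  by (simp add: mult_single plus_list_def)

lemma free_one: "(1 :: 'g free) = free_word []"
  by (simp add: single_one[symmetric] zero_list_def del: single_one)

text \<open>Scalars are multiples of the empty word, the unit for concatenation, so they are
  central; this is checked on words.\<close>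

lemma free_scale_mult_right: "p * free_scale c q = free_scale c (p * q)"
proof -
  have "p * Poly_Mapping.single [] c = Poly_Mapping.single [] c * p"
    using subset_UNIV
  proof (induction p rule: free_induct)
    case (word d w) then show ?case by (simp add: mult_single plus_list_def mult.commute)
  qed (simp_all add: algebra_simps)
  then show ?thesis by (simp add: free_scale_def mult.assoc[symmetric])
qed

section \<open>Linear extension of maps on words\<close>

lemma linear_extend_superset:
  assumes "finite S" "Poly_Mapping.keys p \<subseteq> S"
  shows "linear_extend f p = (\<Sum>w\<in>S. free_scale (Poly_Mapping.lookup p w) (f w))"
  unfolding linear_extend_def using assms
  by (intro sum.mono_neutral_left) (auto simp: in_keys_iff)

lemma linear_extend_add: "linear_extend f (p + q) = linear_extend f p + linear_extend f q"
proof -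
  \<comment> \<open>Coefficients may cancel in the sum, so all three extensions are expanded over a
    common finite superset of the supports.\<close>
  let ?S = "Poly_Mapping.keys p \<union> Poly_Mapping.keys q"
  have "Poly_Mapping.keys (p + q) \<subseteq> ?S" by (rule keys_add)
  then show ?thesis
    by (simp add: linear_extend_superset[of ?S] lookup_add free_scale_add_left sum.distrib)
qed

lemma linear_extend_scale: "linear_extend f (free_scale c p) = free_scale c (linear_extend f p)"
proof -
  have "Poly_Mapping.keys (free_scale c p) \<subseteq> Poly_Mapping.keys p"
    by (auto simp: in_keys_iff)
  then show ?thesis
    by (simp add: linear_extend_superset[of "Poly_Mapping.keys p"] free_scale_sum)
qed

lemma linear_extend_word [simp]: "linear_extend f (free_word w) = f w"
  by (simp add: linear_extend_def)

lemma linear_extend_zero [simp]: "linear_extend f 0 = 0"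
  by (simp add: linear_extend_def)

lemma linear_extend_diff: "linear_extend f (p - q) = linear_extend f p - linear_extend f q"
  using linear_extend_add[of f "p - q" q] by (simp add: algebra_simps)

lemma linear_extend_sum: "linear_extend f (sum p S) = (\<Sum>i\<in>S. linear_extend f (p i))"
  by (induction S rule: infinite_finite_induct) (auto simp: linear_extend_add)

lemma linear_extend_compose:
  "linear_extend f (linear_extend h p) = linear_extend (\<lambda>w. linear_extend f (h w)) p"
  by (simp add: linear_extend_def[of h] linear_extend_def[of "\<lambda>w. linear_extend f (h w)"]
      linear_extend_sum linear_extend_scale)

lemma linear_extend_cong:
  "(\<And>w. w \<in> Poly_Mapping.keys p \<Longrightarrow> f w = h w) \<Longrightarrow> linear_extend f p = linear_extend h p"
  by (simp add: linear_extend_def)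

text \<open>Bilinearity reduces multiplicativity to words, first in the right factor and then in the
  left.\<close>

lemma linear_extend_mult:
  assumes "\<And>v w. f (v @ w) = f v * f w"
  shows "linear_extend f (p * q) = linear_extend f p * linear_extend f q"
proof -
  have left: "linear_extend f (free_word v * q) = f v * linear_extend f q" for v
    using subset_UNIV
  proof (induction q rule: free_induct)
    case (word c w) then show ?case
      by (simp only: free_scale_mult_right free_word_append linear_extend_scale
          linear_extend_word assms)
  qed (simp_all add: linear_extend_add algebra_simps)
  show ?thesis
    using subset_UNIV
  proof (induction p rule: free_induct)
    case (word c w) then show ?case
      by (simp only: free_scale_mult_left linear_extend_scale left linear_extend_word)
  qed (simp_all add: linear_extend_add algebra_simps)
qed

section \<open>The adjoint on the free algebra\<close>

lemma free_adj_superset: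
  assumes "finite S" "Poly_Mapping.keys p \<subseteq> S"
  shows "free_adj G p = (\<Sum>w\<in>S. Poly_Mapping.single (rev (map (gen_adj G) w)) (cnj (Poly_Mapping.lookup p w)))"
  unfolding free_adj_def using assms
  by (intro sum.mono_neutral_left) (auto simp: in_keys_iff)

lemma free_adj_add: "free_adj G (p + q) = free_adj G p + free_adj G q"
proof -
  let ?S = "Poly_Mapping.keys p \<union> Poly_Mapping.keys q"
  have "Poly_Mapping.keys (p + q) \<subseteq> ?S" by (rule keys_add)
  then show ?thesis
    by (simp add: free_adj_superset[of ?S] lookup_add single_add sum.distrib)
qed

lemma free_adj_zero [simp]: "free_adj G 0 = 0"
  by (simp add: free_adj_def)

lemma free_adj_diff: "free_adj G (p - q) = free_adj G p - free_adj G q"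
  using free_adj_add[of G "p - q" q] by (simp add: algebra_simps)

lemma free_adj_sum: "free_adj G (sum p S) = (\<Sum>i\<in>S. free_adj G (p i))"
  by (induction S rule: infinite_finite_induct) (auto simp: free_adj_add)

lemma free_adj_single [simp]:
  "free_adj G (Poly_Mapping.single w c) = Poly_Mapping.single (rev (map (gen_adj G) w)) (cnj c)"
  by (cases "c = 0") (auto simp: free_adj_def)

text \<open>The adjoint conjugates coefficients and reverses products, so
  \<open>linear_extend_mult\<close> does not cover it; the same two-stage reduction is run on single
  terms with their coefficients.\<close>

lemma free_adj_mult: "free_adj G (p * q) = free_adj G q * free_adj G p"
proof -
  have left: "free_adj G (Poly_Mapping.single v d * q)
      = free_adj G q * free_adj G (Poly_Mapping.single v d)" for v d
    using subset_UNIV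
  proof (induction q rule: free_induct)
    case (word c w) then show ?case by (simp add: mult_single plus_list_def mult.commute)
  qed (simp_all add: free_adj_add algebra_simps)
  show ?thesis
    using subset_UNIV
  proof (induction p rule: free_induct)
    case (word c w) then show ?case using left[of w c] by simp
  qed (simp_all add: free_adj_add algebra_simps)
qed

section \<open>The grading and the automorphisms\<close>

text \<open>This is \<open>\<alpha>\<^sub>g\<close> on a generator: among the basis elements
  \<open>(h,g)\<close>, only \<open>h = e\<close> acts nontrivially on a \<open>Delta\<close>, and
  only the conjugate of \<open>t\<close> by \<open>g\<close> on a \<open>Rho t\<close>.\<close>

fun gen_shift :: "('g, 'm) monoid_scheme \<Rightarrow> 'g \<Rightarrow> 'g gen \<Rightarrow> 'g gen" where
  "gen_shift G g (Delta f x) = Delta (g \<otimes>\<^bsub>G\<^esub> f) x"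
| "gen_shift G g (Rho t l) = Rho (g \<otimes>\<^bsub>G\<^esub> t \<otimes>\<^bsub>G\<^esub> inv\<^bsub>G\<^esub> g) l"

definition free_shift :: "('g, 'm) monoid_scheme \<Rightarrow> 'g \<Rightarrow> 'g free \<Rightarrow> 'g free" where
  "free_shift G g = linear_extend (\<lambda>w. free_word (map (gen_shift G g) w))"

fun gen_degree :: "('g, 'm) monoid_scheme \<Rightarrow> 'g gen \<Rightarrow> 'g" where
  "gen_degree G (Delta f x) = \<one>\<^bsub>G\<^esub>"
| "gen_degree G (Rho t l) = t"

primrec word_degree :: "('g, 'm) monoid_scheme \<Rightarrow> 'g gen list \<Rightarrow> 'g" where
  "word_degree G [] = \<one>\<^bsub>G\<^esub>"
| "word_degree G (s # w) = gen_degree G s \<otimes>\<^bsub>G\<^esub> word_degree G w"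

text \<open>The projection \<open>E\<close> onto degree \<open>e\<close>, lifted to words; that it
  respects the relations is shown in \<open>neutral_I\<close>.\<close>

definition free_neutral :: "('g, 'm) monoid_scheme \<Rightarrow> 'g free \<Rightarrow> 'g free" where
  "free_neutral G = linear_extend (\<lambda>w. if word_degree G w = \<one>\<^bsub>G\<^esub> then free_word w else 0)"

text \<open>A closed form, free of coproducts, for the action of \<open>z_double\<close>; the two
  are identified in \<open>free_act_z\<close>.\<close>

definition free_average :: "('g, 'm) monoid_scheme \<Rightarrow> 'g free \<Rightarrow> 'g free" where
  "free_average G p = free_scale (1 / of_nat (order G))
     (\<Sum>g\<in>carrier G. free_shift G g (free_neutral G p))"

lemma free_shift_word [simp]: "free_shift G g (free_word w) = free_word (map (gen_shift G g) w)"
  by (simp add: free_shift_def)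

lemma free_shift_mult: "free_shift G g (p * q) = free_shift G g p * free_shift G g q"
  unfolding free_shift_def by (rule linear_extend_mult) (simp add: free_word_append)

lemma free_neutral_word [simp]:
  "free_neutral G (free_word w) = (if word_degree G w = \<one>\<^bsub>G\<^esub> then free_word w else 0)"
  by (simp add: free_neutral_def)

lemmas free_shift_linear =
  linear_extend_add[of "\<lambda>w. free_word (map (gen_shift G g) w)" for G g, folded free_shift_def]
  linear_extend_diff[of "\<lambda>w. free_word (map (gen_shift G g) w)" for G g, folded free_shift_def]
  linear_extend_sum[of "\<lambda>w. free_word (map (gen_shift G g) w)" for G g, folded free_shift_def]
  linear_extend_scale[of "\<lambda>w. free_word (map (gen_shift G g) w)" for G g, folded free_shift_def]
  linear_extend_zero[of "\<lambda>w. free_word (map (gen_shift G g) w)" for G g, folded free_shift_def]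

lemma free_neutral_linear:
  "free_neutral G (p + q) = free_neutral G p + free_neutral G q"
  "free_neutral G (free_scale c p) = free_scale c (free_neutral G p)"
  "free_neutral G 0 = 0"
  by (simp_all add: free_neutral_def linear_extend_add linear_extend_scale)

lemma free_average_linear:
  "free_average G (p + q) = free_average G p + free_average G q"
  "free_average G (free_scale c p) = free_scale c (free_average G p)"
  "free_average G 0 = 0"
  by (simp_all add: free_average_def free_neutral_linear free_shift_linear sum.distrib
      free_scale_add free_scale_sum mult.commute)

lemma free_average_sum: "free_average G (sum p S) = (\<Sum>i\<in>S. free_average G (p i))"
  by (induction S rule: infinite_finite_induct) (auto simp: free_average_linear)

lemma free_average_word:
  "free_average G (free_word w) = (if word_degree G w = \<one>\<^bsub>G\<^esub>
     then free_scale (1 / of_nat (order G)) (\<Sum>g\<in>carrier G. free_word (map (gen_shift G g) w)) else 0)"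
  by (simp add: free_average_def free_shift_linear)

section \<open>The relations\<close>

locale field_net = normal H G for H and G (structure) +
  assumes finite_G: "finite (carrier G)"
begin

abbreviation "F \<equiv> free_algebra G H"
abbreviation "I \<equiv> relation_ideal G H"
abbreviation "Gen \<equiv> gens G H"

lemma H_carrier: "h \<in> H \<Longrightarrow> h \<in> carrier G" using subset by blast

lemma finite_H: "finite H" using finite_G subset finite_subset by blast

lemma cancel_left_inv: "\<lbrakk>x \<in> carrier G; y \<in> carrier G\<rbrakk> \<Longrightarrow> inv x \<otimes> (x \<otimes> y) = y"
  by (simp add: m_assoc[symmetric])

lemma cancel_left: "\<lbrakk>x \<in> carrier G; y \<in> carrier G\<rbrakk> \<Longrightarrow> x \<otimes> (inv x \<otimes> y) = y"
  by (simp add: m_assoc[symmetric])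

lemmas group_simps = m_assoc inv_mult_group cancel_left_inv cancel_left

lemma conj_closed: "\<lbrakk>g \<in> carrier G; h \<in> H\<rbrakk> \<Longrightarrow> g \<otimes> h \<otimes> inv g \<in> H"
  by (rule inv_op_closed2)

section \<open>The free algebra as a star ring\<close>

lemma gens_simps [simp]:
  "Delta g x \<in> Gen \<longleftrightarrow> g \<in> carrier G"
  "Rho h l \<in> Gen \<longleftrightarrow> h \<in> H \<and> l \<in> half_ints"
  by (auto simp: gens_def)

lemma in_F_iff: "p \<in> carrier F \<longleftrightarrow> Poly_Mapping.keys p \<subseteq> lists Gen"
  by (simp add: free_algebra_def)

lemma F_simps [simp]: "\<one>\<^bsub>F\<^esub> = 1" "\<zero>\<^bsub>F\<^esub> = 0" "p \<oplus>\<^bsub>F\<^esub> q = p + q" "p \<otimes>\<^bsub>F\<^esub> q = p * q"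
  "c \<odot>\<^bsub>F\<^esub> p = free_scale c p" "adj F p = free_adj G p"
  by (simp_all add: free_algebra_def)

lemma F_zero [simp]: "0 \<in> carrier F" by (simp add: in_F_iff)

lemma F_single [simp]: "w \<in> lists Gen \<Longrightarrow> Poly_Mapping.single w c \<in> carrier F"
  by (simp add: in_F_iff)

lemma F_one [simp]: "1 \<in> carrier F" unfolding free_one by (rule F_single) simp

lemma F_add [simp]: "\<lbrakk>p \<in> carrier F; q \<in> carrier F\<rbrakk> \<Longrightarrow> p + q \<in> carrier F"
  using keys_add[of p q] by (auto simp: in_F_iff)

lemma F_mult [simp]: "\<lbrakk>p \<in> carrier F; q \<in> carrier F\<rbrakk> \<Longrightarrow> p * q \<in> carrier F"
  using keys_mult[of p q] by (fastforce simp: in_F_iff plus_list_def)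

lemma F_scale [simp]: "p \<in> carrier F \<Longrightarrow> free_scale c p \<in> carrier F"
  by (auto simp: in_F_iff) (metis in_keys_iff in_listsD lookup_free_scale mult_zero_right subsetD)

lemma F_uminus [simp]: "p \<in> carrier F \<Longrightarrow> - p \<in> carrier F"
  using F_scale[of p "-1"] by simp

lemma F_diff [simp]: "\<lbrakk>p \<in> carrier F; q \<in> carrier F\<rbrakk> \<Longrightarrow> p - q \<in> carrier F"
  using F_add[of p "- q"] by simp

lemma F_sum [simp]: "(\<And>i. i \<in> S \<Longrightarrow> p i \<in> carrier F) \<Longrightarrow> sum p S \<in> carrier F"
  by (induction S rule: infinite_finite_induct) auto

lemma F_induct [consumes 1, case_names zero word add]:
  assumes "p \<in> carrier F" "P 0" "\<And>c w. w \<in> lists Gen \<Longrightarrow> P (free_scale c (free_word w))"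
    "\<And>p q. \<lbrakk>p \<in> carrier F; q \<in> carrier F; P p; P q\<rbrakk> \<Longrightarrow> P (p + q)"
  shows "P p"
  using assms(1)[unfolded in_F_iff]
  by (induction p rule: free_induct) (use assms(2-4) in \<open>auto simp: in_F_iff\<close>)

lemma F_linear_extend:
  assumes "p \<in> carrier F" "\<And>w. w \<in> lists Gen \<Longrightarrow> f w \<in> carrier F"
  shows "linear_extend f p \<in> carrier F"
  using assms(1) by (induction p rule: F_induct) (auto simp: linear_extend_add linear_extend_scale assms(2)
      simp del: free_scale_simps(5))

lemma gen_adj_in [simp]: "s \<in> Gen \<Longrightarrow> gen_adj G s \<in> Gen"
  by (cases s) auto

lemma gen_shift_in [simp]: "\<lbrakk>s \<in> Gen; g \<in> carrier G\<rbrakk> \<Longrightarrow> gen_shift G g s \<in> Gen"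
  by (cases s) (auto simp: conj_closed)

lemma map_gen_shift_in [simp]: "\<lbrakk>w \<in> lists Gen; g \<in> carrier G\<rbrakk> \<Longrightarrow> map (gen_shift G g) w \<in> lists Gen"
  by auto

lemma F_adj [simp]: "p \<in> carrier F \<Longrightarrow> free_adj G p \<in> carrier F"
  by (induction p rule: F_induct) (auto simp: free_adj_add intro!: F_single)

lemma F_shift [simp]: "\<lbrakk>p \<in> carrier F; g \<in> carrier G\<rbrakk> \<Longrightarrow> free_shift G g p \<in> carrier F"
  unfolding free_shift_def by (rule F_linear_extend) auto

lemma F_neutral [simp]: "p \<in> carrier F \<Longrightarrow> free_neutral G p \<in> carrier F"
  unfolding free_neutral_def by (rule F_linear_extend) auto

lemma F_average [simp]: "p \<in> carrier F \<Longrightarrow> free_average G p \<in> carrier F"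
  by (simp add: free_average_def)

lemma gen_adj_adj: "s \<in> Gen \<Longrightarrow> gen_adj G (gen_adj G s) = s"
  by (cases s) (auto simp: H_carrier)

lemma free_adj_adj: "p \<in> carrier F \<Longrightarrow> free_adj G (free_adj G p) = p"
proof (induction p rule: F_induct)
  case (word c w)
  then have "map (gen_adj G \<circ> gen_adj G) w = w"
    by (intro map_idI) (auto simp: gen_adj_adj)
  then show ?case by (simp add: rev_map[symmetric])
qed (auto simp: free_adj_add)

lemma star_ring_free: "star_ring F"
proof -
  have "abelian_group F"
  proof (rule abelian_groupI)
    fix p assume "p \<in> carrier F"
    then show "\<exists>q\<in>carrier F. q \<oplus>\<^bsub>F\<^esub> p = \<zero>\<^bsub>F\<^esub>" by (intro bexI[of _ "- p"]) auto
  qed (auto simp: algebra_simps)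
  moreover have "Group.monoid F"
    by (rule monoidI) (auto simp: algebra_simps)
  ultimately interpret F: ring F
    by (rule ringI) (auto simp: algebra_simps)
  have "\<ominus>\<^bsub>F\<^esub> p = - p" if "p \<in> carrier F" for p
    using that by (intro F.minus_equality) auto
  then show ?thesis
    by unfold_locales (auto simp: free_scale_add free_scale_mult_left free_scale_mult_right
        free_adj_add free_adj_mult free_adj_adj)
qed

lemma F_minus: "\<lbrakk>p \<in> carrier F; q \<in> carrier F\<rbrakk> \<Longrightarrow> p \<ominus>\<^bsub>F\<^esub> q = p - q"
proof -
  interpret F: star_ring F by (rule star_ring_free)
  assume "p \<in> carrier F" "q \<in> carrier F"
  moreover from this have "\<ominus>\<^bsub>F\<^esub> q = - q" by (intro F.minus_equality) auto
  ultimately show ?thesis by (simp add: a_minus_def)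
qed

section \<open>The relation ideal and its congruence\<close>

lemma relators_subset: "relators G H \<subseteq> carrier F"
  unfolding relators_def
  by (auto intro!: F_diff F_mult F_sum F_single simp: H_carrier)

lemma ideal_I: "ideal I F"
proof -
  interpret F: star_ring F by (rule star_ring_free)
  show ?thesis unfolding relation_ideal_def by (rule F.genideal_ideal[OF relators_subset])
qed

lemma I_subset: "p \<in> I \<Longrightarrow> p \<in> carrier F"
  using ideal.Icarr[OF ideal_I] .

lemma I_add: "\<lbrakk>p \<in> I; q \<in> I\<rbrakk> \<Longrightarrow> p + q \<in> I"
  using additive_subgroup.a_closed[OF ideal.axioms(1)[OF ideal_I], of p q] by (simp only: F_simps)

lemma I_zero: "0 \<in> I"
  using additive_subgroup.zero_closed[OF ideal.axioms(1)[OF ideal_I]] by (simp only: F_simps)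

lemma I_mult_left: "\<lbrakk>p \<in> I; q \<in> carrier F\<rbrakk> \<Longrightarrow> q * p \<in> I"
  using ideal.I_l_closed[OF ideal_I, of p q] by (simp only: F_simps)

lemma I_mult_right: "\<lbrakk>p \<in> I; q \<in> carrier F\<rbrakk> \<Longrightarrow> p * q \<in> I"
  using ideal.I_r_closed[OF ideal_I, of p q] by (simp only: F_simps)

lemma I_scale: "p \<in> I \<Longrightarrow> free_scale c p \<in> I"
  using I_mult_left[of p "free_scale c 1"] by (simp add: free_scale_mult_left)

lemma I_uminus: "p \<in> I \<Longrightarrow> - p \<in> I"
  using I_scale[of p "-1"] by simp

lemma relator_in_I: "r \<in> relators G H \<Longrightarrow> r \<in> I"
proof -
  interpret F: star_ring F by (rule star_ring_free)
  show "r \<in> relators G H \<Longrightarrow> r \<in> I" unfolding relation_ideal_def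
    using F.genideal_self[OF relators_subset] by blast
qed

text \<open>Both sides are required to lie in the carrier, so that congruences can be chained and
  multiplied without separate membership goals.\<close>

definition eqv :: "'a free \<Rightarrow> 'a free \<Rightarrow> bool" (infix \<open>\<approx>\<close> 50) where
  "p \<approx> q \<longleftrightarrow> p \<in> carrier F \<and> q \<in> carrier F \<and> p - q \<in> I"

lemma eqv_refl [simp]: "p \<in> carrier F \<Longrightarrow> p \<approx> p"
  by (simp add: eqv_def I_zero)

lemma eqv_sym: "p \<approx> q \<Longrightarrow> q \<approx> p"
  using I_uminus[of "p - q"] by (simp add: eqv_def)

lemma eqv_trans [trans]: "\<lbrakk>p \<approx> q; q \<approx> r\<rbrakk> \<Longrightarrow> p \<approx> r"
  using I_add[of "p - q" "q - r"] by (simp add: eqv_def)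

lemma eqv_add: "\<lbrakk>p \<approx> q; p' \<approx> q'\<rbrakk> \<Longrightarrow> p + p' \<approx> q + q'"
  using I_add[of "p - q" "p' - q'"] by (simp add: eqv_def algebra_simps)

lemma eqv_mult:
  assumes "p \<approx> q" "p' \<approx> q'" shows "p * p' \<approx> q * q'"
proof -
  \<comment> \<open>This sum telescopes to \<open>p * p' - q * q'\<close>, and each of its terms is
    absorbed by the two-sided ideal.\<close>
  have "(p - q) * p' + q * (p' - q') \<in> I"
    using assms by (intro I_add I_mult_left I_mult_right) (auto simp: eqv_def)
  then show ?thesis using assms by (simp add: eqv_def algebra_simps)
qed

lemma eqv_scale: "p \<approx> q \<Longrightarrow> free_scale c p \<approx> free_scale c q"
  using I_scale[of "p - q" c] by (simp add: eqv_def free_scale_diff)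

lemma eqv_sum: "(\<And>i. i \<in> S \<Longrightarrow> p i \<approx> q i) \<Longrightarrow> sum p S \<approx> sum q S"
  by (induction S rule: infinite_finite_induct) (auto intro: eqv_add)

text \<open>Rewriting inside a word. The replacement \<open>q\<close> is an arbitrary element
  because a product of two deltas may become zero.\<close>

lemma eqv_context:
  assumes "free_word a \<approx> q" "u \<in> lists Gen" "v \<in> lists Gen"
  shows "free_word (u @ a @ v) \<approx> free_word u * q * free_word v"
proof -
  have "free_word u * free_word a * free_word v \<approx> free_word u * q * free_word v"
    using assms by (intro eqv_mult) auto
  then show ?thesis by (simp add: free_word_append)
qed

lemma sum_delta: "(\<Sum>g\<in>carrier G. fdelta g x) \<approx> 1"
  unfolding eqv_def by (intro conjI relator_in_I F_sum) (auto simp: relators_def)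

lemma rho_one: "l \<in> half_ints \<Longrightarrow> frho \<one> l \<approx> free_word []"
  unfolding eqv_def by (intro conjI relator_in_I) (auto simp: relators_def free_one[symmetric])

lemma delta_delta:
  assumes g: "g1 \<in> carrier G" "g2 \<in> carrier G"
  shows "free_word [Delta g1 x, Delta g2 x] \<approx> (if g1 = g2 then fdelta g1 x else 0)"
proof -
  \<comment> \<open>The proof walks explicitly through the nested union to the third of the eight
    families of relators.\<close>
  have "fdelta g1 x * fdelta g2 x - (if g1 = g2 then fdelta g1 x else 0) \<in> relators G H"
    unfolding relators_def
    by (rule UnI1, rule UnI1, rule UnI1, rule UnI1, rule UnI1, rule UnI2) (use g in blast)
  then show ?thesis using g by (simp add: eqv_def relator_in_I free_word_append)
qed

lemma rho_rho:
  "\<lbrakk>h1 \<in> H; h2 \<in> H; l \<in> half_ints\<rbrakk> \<Longrightarrow> free_word [Rho h1 l, Rho h2 l] \<approx> frho (h1 \<otimes> h2) l"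
  unfolding eqv_def free_word_append[of "[Rho h1 l]" "[Rho h2 l]", simplified, symmetric]
  by (intro conjI relator_in_I F_mult) (auto simp: relators_def)

lemma delta_commute:
  assumes g: "g1 \<in> carrier G" "g2 \<in> carrier G"
  shows "free_word [Delta g1 x, Delta g2 x'] \<approx> free_word [Delta g2 x', Delta g1 x]"
proof -
  have "fdelta g1 x * fdelta g2 x' - fdelta g2 x' * fdelta g1 x \<in> relators G H"
    unfolding relators_def using g by blast
  then show ?thesis using g by (simp add: eqv_def relator_in_I free_word_append)
qed

lemma rho_delta_less:
  "\<lbrakk>h \<in> H; g \<in> carrier G; l \<in> half_ints; l < of_int x\<rbrakk>
    \<Longrightarrow> free_word [Rho h l, Delta g x] \<approx> free_word [Delta (h \<otimes> g) x, Rho h l]"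
  unfolding eqv_def free_word_append[of "[Rho h l]" "[Delta g x]", simplified, symmetric]
   free_word_append[of "[Delta (h \<otimes> g) x]" "[Rho h l]", simplified, symmetric]
  by (intro conjI relator_in_I F_mult) (auto simp: relators_def H_carrier)

lemma rho_delta_greater:
  "\<lbrakk>h \<in> H; g \<in> carrier G; l \<in> half_ints; l > of_int x\<rbrakk>
    \<Longrightarrow> free_word [Rho h l, Delta g x] \<approx> free_word [Delta g x, Rho h l]"
  unfolding eqv_def free_word_append[of "[Rho h l]" "[Delta g x]", simplified, symmetric]
   free_word_append[of "[Delta g x]" "[Rho h l]", simplified, symmetric]
  by (intro conjI relator_in_I F_mult) (auto simp: relators_def H_carrier)

lemma rho_exchange:
  "\<lbrakk>h1 \<in> H; h2 \<in> H; l \<in> half_ints; l' \<in> half_ints; l > l'\<rbrakk>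
    \<Longrightarrow> free_word [Rho h1 l, Rho h2 l'] \<approx> free_word [Rho h2 l', Rho (inv h2 \<otimes> h1 \<otimes> h2) l]"
  unfolding eqv_def free_word_append[of "[Rho h1 l]" "[Rho h2 l']", simplified, symmetric]
   free_word_append[of "[Rho h2 l']" "[Rho (inv h2 \<otimes> h1 \<otimes> h2) l]", simplified, symmetric]
  by (intro conjI relator_in_I F_mult) (auto simp: relators_def)

text \<open>Since \<open>I\<close> is two-sided, its preimage under an additive map that preserves
  or reverses products is an ideal; once it contains the relators it contains \<open>I\<close>. The
  disjunction admits both the shifts and the adjoint.\<close>

lemma ideal_preimage:
  assumes closed: "\<And>p. p \<in> carrier F \<Longrightarrow> f p \<in> carrier F"
    and add: "\<And>p q. f (p + q) = f p + f q"
    and mult: "\<And>p q. \<lbrakk>p \<in> carrier F; q \<in> carrier F\<rbrakk> \<Longrightarrow> f (p * q) = f p * f q \<or> f (p * q) = f q * f p"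
    and rel: "\<And>r. r \<in> relators G H \<Longrightarrow> f r \<in> I" and p: "p \<in> I"
  shows "f p \<in> I"
proof -
  interpret F: star_ring F by (rule star_ring_free)
  let ?J = "{p \<in> carrier F. f p \<in> I}"
  have z: "f 0 = 0" using add[of 0 0] by simp
  have m: "f (- p) = - f p" for p using add[of p "- p"] z by (simp add: add_eq_0_iff)
  have inv: "inv\<^bsub>add_monoid F\<^esub> p = - p" if "p \<in> carrier F" for p
    using that F.minus_equality[of "- p" p] by (simp add: a_inv_def[of F])
  have "ideal ?J F"
  proof (rule idealI[OF F.ring_axioms])
    show "subgroup ?J (add_monoid F)"
    proof (rule subgroup.intro)
      fix p assume "p \<in> ?J"
      then show "inv\<^bsub>add_monoid F\<^esub> p \<in> ?J" using inv[of p] by (auto simp only: mem_Collect_eq m F_uminus I_uminus)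
    qed (auto simp: add I_add z I_zero)
    fix a x assume a: "a \<in> ?J" and x: "x \<in> carrier F"
    have "f x * f a \<in> I" "f a * f x \<in> I"
      using a closed[OF x] by (auto intro: I_mult_left I_mult_right)
    then show "x \<otimes>\<^bsub>F\<^esub> a \<in> ?J" "a \<otimes>\<^bsub>F\<^esub> x \<in> ?J"
      using a x mult[of x a] mult[of a x] by auto
  qed
  moreover have "relators G H \<subseteq> ?J" using rel relators_subset by auto
  ultimately have "I \<subseteq> ?J" unfolding relation_ideal_def by (rule F.genideal_minimal)
  then show ?thesis using p by blast
qed

lemma eqv_diff: "p \<approx> q \<Longrightarrow> p - q \<in> I" by (simp add: eqv_def)

text \<open>Products and the unit are presented as words here, so that maps defined on words can be
  evaluated on each relator by simplification.\<close>

lemma relator_cases [consumes 1, case_names sum one dd rr dc rdl rdg re]: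
  assumes "r \<in> relators G H"
  obtains x where "r = (\<Sum>g\<in>carrier G. fdelta g x) - free_word []"
  | l where "r = frho \<one> l - free_word []" "l \<in> half_ints"
  | g1 g2 x where "r = free_word [Delta g1 x, Delta g2 x] - (if g1 = g2 then fdelta g1 x else 0)"
      "g1 \<in> carrier G" "g2 \<in> carrier G"
  | h1 h2 l where "r = free_word [Rho h1 l, Rho h2 l] - frho (h1 \<otimes> h2) l"
      "h1 \<in> H" "h2 \<in> H" "l \<in> half_ints"
  | g1 g2 x x' where "r = free_word [Delta g1 x, Delta g2 x'] - free_word [Delta g2 x', Delta g1 x]"
      "g1 \<in> carrier G" "g2 \<in> carrier G"
  | h g l x where "r = free_word [Rho h l, Delta g x] - free_word [Delta (h \<otimes> g) x, Rho h l]"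
      "h \<in> H" "g \<in> carrier G" "l \<in> half_ints" "l < of_int x"
  | h g l x where "r = free_word [Rho h l, Delta g x] - free_word [Delta g x, Rho h l]"
      "h \<in> H" "g \<in> carrier G" "l \<in> half_ints" "l > of_int x"
  | h1 h2 l l' where
      "r = free_word [Rho h1 l, Rho h2 l'] - free_word [Rho h2 l', Rho (inv h2 \<otimes> h1 \<otimes> h2) l]"
      "h1 \<in> H" "h2 \<in> H" "l \<in> half_ints" "l' \<in> half_ints" "l > l'"
  using assms unfolding relators_def free_word_append free_one append_Cons append_Nil
proof (elim UnE CollectE exE conjE, goal_cases)
  case 1 show ?case by (rule that(1)[OF 1(9)])
next
  case 2 show ?case by (rule that(2)[OF 2(9-10)])
next
  case 3 show ?case by (rule that(3)[OF 3(9-11)])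
next
  case 4 show ?case by (rule that(4)[OF 4(9-12)])
next
  case 5 show ?case by (rule that(5)[OF 5(9-11)])
next
  case 6 show ?case by (rule that(6)[OF 6(9-13)])
next
  case 7 show ?case by (rule that(7)[OF 7(9-13)])
next
  case 8 show ?case by (rule that(8)[OF 8(9-14)])
qed

text \<open>Left translation by \<open>g\<close> permutes \<open>G\<close>, and conjugation by
  \<open>g\<close> is an automorphism preserving the normal subgroup \<open>H\<close>; hence the
  shift of a relator is a relator of the same kind.\<close>

lemma shift_I:
  assumes g: "g \<in> carrier G" and "p \<in> I" shows "free_shift G g p \<in> I"
proof (rule ideal_preimage[OF _ _ _ _ \<open>p \<in> I\<close>])
  fix r assume "r \<in> relators G H"
  then show "free_shift G g r \<in> I"
  proof (cases rule: relator_cases)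
    case (sum x)
    have "(\<Sum>f\<in>carrier G. fdelta (g \<otimes> f) x) = (\<Sum>f\<in>carrier G. fdelta f x)"
      by (rule sum.reindex_bij_witness[of _ "\<lambda>f. inv g \<otimes> f" "\<lambda>f. g \<otimes> f"])
        (use g in \<open>auto simp: group_simps\<close>)
    with sum_delta[of x] show ?thesis by (simp add: sum free_shift_linear eqv_def free_one)
  next
    case (dd g1 g2 x)
    show ?thesis using eqv_diff[OF delta_delta[of "g \<otimes> g1" "g \<otimes> g2" x]] dd g
      by (auto simp: free_shift_linear split: if_splits)
  next
    case (one l)
    then show ?thesis using g rho_one[of l] by (simp add: free_shift_linear eqv_def)
  next
    case (rr h1 h2 l)
    have "g \<otimes> (h1 \<otimes> h2) \<otimes> inv g = (g \<otimes> h1 \<otimes> inv g) \<otimes> (g \<otimes> h2 \<otimes> inv g)"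
      using rr g by (simp add: H_carrier group_simps)
    then show ?thesis
      using eqv_diff[OF rho_rho[of "g \<otimes> h1 \<otimes> inv g" "g \<otimes> h2 \<otimes> inv g" l]] rr g
      by (simp add: free_shift_linear conj_closed)
  next
    case (dc g1 g2 x x')
    then show ?thesis using g eqv_diff[OF delta_commute[of "g \<otimes> g1" "g \<otimes> g2" x x']]
      by (simp add: free_shift_linear)
  next
    case (rdl h f l x)
    have "g \<otimes> (h \<otimes> f) = (g \<otimes> h \<otimes> inv g) \<otimes> (g \<otimes> f)"
      using rdl g by (simp add: H_carrier group_simps)
    then show ?thesis
      using eqv_diff[OF rho_delta_less[of "g \<otimes> h \<otimes> inv g" "g \<otimes> f" l x]] rdl g
      by (simp add: free_shift_linear conj_closed)
  next
    case (rdg h f l x)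
    then show ?thesis
      using eqv_diff[OF rho_delta_greater[of "g \<otimes> h \<otimes> inv g" "g \<otimes> f" l x]] g
      by (simp add: free_shift_linear conj_closed)
  next
    case (re h1 h2 l l')
    have "g \<otimes> (inv h2 \<otimes> h1 \<otimes> h2) \<otimes> inv g
        = inv (g \<otimes> h2 \<otimes> inv g) \<otimes> (g \<otimes> h1 \<otimes> inv g) \<otimes> (g \<otimes> h2 \<otimes> inv g)"
      using re g by (simp add: H_carrier group_simps)
    then show ?thesis
      using eqv_diff[OF rho_exchange[of "g \<otimes> h1 \<otimes> inv g" "g \<otimes> h2 \<otimes> inv g" l l']] re g
      by (simp add: free_shift_linear conj_closed)
  qed
qed (auto simp: free_shift_linear free_shift_mult g)

text \<open>Reversing the words and inverting the labels in \<open>H\<close> turns each relator, up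
  to sign, into a relator of the same kind.\<close>

lemma adj_I:
  assumes "p \<in> I" shows "free_adj G p \<in> I"
proof (rule ideal_preimage[OF _ _ _ _ assms])
  fix r assume "r \<in> relators G H"
  then show "free_adj G r \<in> I"
  proof (cases rule: relator_cases)
    case (sum x)
    then show ?thesis using sum_delta[of x] by (simp add: free_adj_diff free_adj_sum eqv_def free_one)
  next
    case (one l)
    then show ?thesis using rho_one[of l] by (simp add: free_adj_diff eqv_def)
  next
    case (dd g1 g2 x)
    show ?thesis using eqv_diff[OF delta_delta[OF dd(3,2), of x]] dd(1)
      by (auto simp: free_adj_diff split: if_splits)
  next
    case (rr h1 h2 l)
    show ?thesis using eqv_diff[OF rho_rho[of "inv h2" "inv h1" l]] rr
      by (simp add: free_adj_diff inv_mult_group H_carrier)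
  next
    case (dc g1 g2 x x')
    show ?thesis using eqv_diff[OF delta_commute[OF dc(3,2), of x' x]] dc(1)
      by (simp add: free_adj_diff)
  next
    case (rdl h g l x)
    \<comment> \<open>Reversal exchanges the two sides, so the relation is read backwards, with
      \<open>inv h\<close> and \<open>h \<otimes> g\<close> in place of \<open>h\<close> and
      \<open>g\<close>.\<close>
    show ?thesis
      using eqv_diff[OF eqv_sym[OF rho_delta_less[of "inv h" "h \<otimes> g" l x]]] rdl
      by (simp add: free_adj_diff H_carrier cancel_left_inv)
  next
    case (rdg h g l x)
    show ?thesis
      using eqv_diff[OF eqv_sym[OF rho_delta_greater[of "inv h" g l x]]] rdg
      by (simp add: free_adj_diff)
  next
    case (re h1 h2 l l')
    \<comment> \<open>The exchange relation is used for this conjugate of \<open>inv h1\<close>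
      together with \<open>inv h2\<close>; conjugating back by \<open>h2\<close> recovers
      \<open>inv h1\<close>.\<close>
    have "inv h2 \<otimes> inv h1 \<otimes> h2 \<in> H" using re by simp
    moreover have "h2 \<otimes> (inv h2 \<otimes> inv h1 \<otimes> h2) \<otimes> inv h2 = inv h1"
      "inv (inv h2 \<otimes> h1 \<otimes> h2) = inv h2 \<otimes> inv h1 \<otimes> h2"
      using re by (simp_all add: H_carrier group_simps)
    ultimately show ?thesis
      using eqv_diff[OF eqv_sym[OF rho_exchange[of "inv h2 \<otimes> inv h1 \<otimes> h2" "inv h2" l l']]] re
      by (simp add: free_adj_diff H_carrier)
  qed
qed (auto simp: free_adj_add free_adj_mult)

lemma star_ideal_I: "star_ideal I F"
proof -
  interpret F: star_ring F by (rule star_ring_free)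
  interpret ideal I F by (rule ideal_I)
  show ?thesis
    by unfold_locales (simp_all add: I_scale adj_I)
qed

section \<open>The action of the double on words\<close>

lemma word_degree_closed: "w \<in> lists Gen \<Longrightarrow> word_degree G w \<in> H"
proof (induction w)
  case (Cons s w)
  then show ?case by (cases s) auto
qed simp

lemma word_degree_append:
  "\<lbrakk>v \<in> lists Gen; w \<in> lists Gen\<rbrakk> \<Longrightarrow> word_degree G (v @ w) = word_degree G v \<otimes> word_degree G w"
proof (induction v)
  case Nil
  then show ?case by (simp add: H_carrier word_degree_closed)
next
  case (Cons s v)
  then show ?case using word_degree_closed[of v] word_degree_closed[of w]
    by (cases s) (auto simp: H_carrier m_assoc)
qed

lemma word_degree_shift:
  "\<lbrakk>w \<in> lists Gen; g \<in> carrier G\<rbrakk>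
    \<Longrightarrow> word_degree G (map (gen_shift G g) w) = g \<otimes> word_degree G w \<otimes> inv g"
proof (induction w)
  case (Cons s w)
  then show ?case using word_degree_closed[of w]
    by (cases s) (auto simp: H_carrier group_simps)
qed simp

lemma conj_eq_one_iff:
  assumes "g \<in> carrier G" "h \<in> carrier G" shows "g \<otimes> h \<otimes> inv g = \<one> \<longleftrightarrow> h = \<one>"
proof
  assume "g \<otimes> h \<otimes> inv g = \<one>"
  then have "inv g \<otimes> (g \<otimes> h \<otimes> inv g) \<otimes> g = \<one>" using assms by simp
  then show "h = \<one>" using assms by (simp add: group_simps)
qed (use assms in simp)

lemma gen_shift_shift:
  "\<lbrakk>s \<in> Gen; g \<in> carrier G; g' \<in> carrier G\<rbrakk>
    \<Longrightarrow> gen_shift G g' (gen_shift G g s) = gen_shift G (g' \<otimes> g) s"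
  by (cases s) (auto simp: H_carrier group_simps)

lemma gen_shift_one: "s \<in> Gen \<Longrightarrow> gen_shift G \<one> s = s"
  by (cases s) (auto simp: H_carrier)

lemma map_shift_one: "w \<in> lists Gen \<Longrightarrow> map (gen_shift G \<one>) w = w"
  by (intro map_idI) (auto simp: gen_shift_one)

text \<open>In the coproduct sum only one \<open>t\<close> acts nontrivially on the first letter,
  namely its conjugated degree, so the sum collapses at every letter. The induction generalizes
  \<open>h\<close> because the tail is acted on with \<open>inv t \<otimes> h\<close>.\<close>

lemma word_act_eq:
  assumes "w \<in> lists Gen" "g \<in> carrier G" "h \<in> H"
  shows "word_act G H w h g =
    (if h = g \<otimes> word_degree G w \<otimes> inv g then free_word (map (gen_shift G g) w) else 0)"
  using assms(1,3)
proof (induction w arbitrary: h rule: list.induct)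
  case Nil
  then show ?case using assms(2) by (simp add: free_one)
next
  case (Cons s w)
  then have s: "s \<in> Gen" and w: "w \<in> lists Gen" by auto
  note g = assms(2)
  define d where "d = gen_degree G s"
  define e where "e = word_degree G w"
  have d: "d \<in> H" using s by (cases s) (auto simp: d_def)
  have e: "e \<in> H" using w by (simp add: e_def word_degree_closed)
  let ?d = "g \<otimes> d \<otimes> inv g"
  have dH: "?d \<in> H" using g d by (rule conj_closed)
  have act: "gen_act G t g s = (if t = ?d then free_word [gen_shift G g s] else 0)" if "t \<in> H" for t
    using s g by (cases s) (auto simp: d_def)
  have "word_act G H (s # w) h g = (\<Sum>t\<in>H. if t = ?d then
      free_word [gen_shift G g s] * word_act G H w (inv t \<otimes> h) g else 0)"
    by (simp add: act if_distrib[of "\<lambda>x. x * _"] cong: sum.cong if_cong)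
  also have "\<dots> = free_word [gen_shift G g s] * word_act G H w (inv ?d \<otimes> h) g"
    using dH finite_H by simp
  also have "\<dots> = free_word [gen_shift G g s] * (if inv ?d \<otimes> h = g \<otimes> e \<otimes> inv g
      then free_word (map (gen_shift G g) w) else 0)"
    using Cons.IH[OF w, of "inv ?d \<otimes> h"] dH Cons.prems(2) by (simp add: e_def)
  also have "inv ?d \<otimes> h = g \<otimes> e \<otimes> inv g \<longleftrightarrow> h = ?d \<otimes> (g \<otimes> e \<otimes> inv g)"
    using dH e g Cons.prems(2) by (intro inv_solve_left') (auto simp: H_carrier)
  also have "?d \<otimes> (g \<otimes> e \<otimes> inv g) = g \<otimes> word_degree G (s # w) \<otimes> inv g"
    using d e g by (simp add: H_carrier group_simps flip: d_def e_def)
  finally show ?case by (simp add: free_word_append)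
qed

lemma z_double_apply:
  assumes "g \<in> carrier G"
  shows "z_double G (h, g) = (if h = \<one> then 1 / of_nat (order G) else 0)"
proof -
  have "(\<Sum>f\<in>carrier G. double_basis \<one> f (h, g)) = (\<Sum>f\<in>carrier G. if f = g then (if h = \<one> then 1 else 0) else 0)"
    by (intro sum.cong) (auto simp: double_basis_def)
  then show ?thesis using assms finite_G by (simp add: z_double_def)
qed

text \<open>Only \<open>h = e\<close> occurs in \<open>z_double\<close>, and the conjugate of a
  degree is trivial exactly when the degree is, so \<open>word_act_eq\<close> leaves the neutral
  part followed by a shift.\<close>

lemma free_act_z:
  assumes "p \<in> carrier F" shows "free_act G H (z_double G) p = free_average G p"
proof -
  have act: "linear_extend (\<lambda>w. word_act G H w \<one> g) p = free_shift G g (free_neutral G p)"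
    if g: "g \<in> carrier G" for g
    unfolding free_shift_def free_neutral_def linear_extend_compose
  proof (rule linear_extend_cong)
    fix w assume "w \<in> Poly_Mapping.keys p"
    then have w: "w \<in> lists Gen" using assms by (auto simp: in_F_iff)
    have "\<one> = g \<otimes> word_degree G w \<otimes> inv g \<longleftrightarrow> word_degree G w = \<one>"
      using conj_eq_one_iff[OF g, of "word_degree G w"] word_degree_closed[OF w] by (auto simp: H_carrier)
    then show "word_act G H w \<one> g = linear_extend (\<lambda>w. free_word (map (gen_shift G g) w))
        (if word_degree G w = \<one> then free_word w else 0)"
      using word_act_eq[OF w g, of \<one>] by simp
  qed
  have "free_act G H (z_double G) p = (\<Sum>h\<in>H. if h = \<one> then (\<Sum>g\<in>carrier G.
      free_scale (1 / of_nat (order G)) (linear_extend (\<lambda>w. word_act G H w h g) p)) else 0)"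
    unfolding free_act_def by (intro sum.cong) (auto simp: z_double_apply)
  also have "\<dots> = (\<Sum>g\<in>carrier G.
      free_scale (1 / of_nat (order G)) (linear_extend (\<lambda>w. word_act G H w \<one> g) p))"
    using finite_H by simp
  also have "\<dots> = free_average G p" by (simp add: act free_average_def free_scale_sum)
  finally show ?thesis .
qed

text \<open>A preliminary shift by \<open>g\<close> only permutes the sum over the group, via
  \<open>f \<mapsto> f \<otimes> g\<close>, so all \<open>order G\<close> terms have the same
  average. This will place the values of the action in the fixed-point algebra.\<close>

lemma free_average_idem:
  assumes "p \<in> carrier F" shows "free_average G (free_average G p) = free_average G p"
  using assms
proof (induction p rule: F_induct)
  case (word c w)
  let ?n = "of_nat (order G) :: complex"
  have n: "?n \<noteq> 0" using order_gt_0_iff_finite finite_G by simp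
  show ?case
  proof (cases "word_degree G w = \<one>")
    case True
    have "free_average G (free_word (map (gen_shift G g) w)) = free_average G (free_word w)"
      if g: "g \<in> carrier G" for g
    proof -
      have "(\<Sum>f\<in>carrier G. free_word (map (gen_shift G f) (map (gen_shift G g) w)))
          = (\<Sum>f\<in>carrier G. free_word (map (gen_shift G (f \<otimes> g)) w))"
        using word g by (intro sum.cong refl arg_cong[where f = free_word])
          (auto simp: gen_shift_shift)
      also have "\<dots> = (\<Sum>f\<in>carrier G. free_word (map (gen_shift G f) w))"
        by (rule sum.reindex_bij_witness[of _ "\<lambda>f. f \<otimes> inv g" "\<lambda>f. f \<otimes> g"])
          (use g in \<open>auto simp: m_assoc\<close>)
      finally show ?thesis
        using word g True by (simp add: free_average_word word_degree_shift del: map_map)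
    qed
    then have "free_average G (\<Sum>g\<in>carrier G. free_word (map (gen_shift G g) w))
        = free_scale ?n (free_average G (free_word w))"
      by (simp add: free_average_sum order_def free_sum_const del: sum_constant cong: sum.cong)
    then have "free_average G (free_average G (free_word w)) = free_average G (free_word w)"
      using n True by (simp add: free_average_word[of G w] free_average_linear)
    then show ?thesis by (simp only: free_average_linear)
  next
    case False
    then show ?thesis by (simp only: free_average_linear free_average_word if_False free_scale_simps(1))
  qed
qed (simp_all add: free_average_linear)

section \<open>Compression by the projections at a distant site\<close>

lemma free_word_Nil_mult [simp]: "free_word [] * p = p" "p * free_word [] = p"
  by (simp_all flip: free_one)

lemma eqv_word_context:
  assumes "free_word a \<approx> free_word b" "u \<in> lists Gen" "v \<in> lists Gen"
  shows "free_word (u @ a @ v) \<approx> free_word (u @ b @ v)"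
  using eqv_context[OF assms] by (simp add: free_word_append)

text \<open>As \<open>x\<close> lies to the right of every \<open>Rho h\<close> in \<open>w\<close>,
  crossing such a letter multiplies the index by \<open>h\<close> on the left, while
  \<open>Delta\<close> letters commute; the accumulated factor is the degree.\<close>

lemma word_delta:
  assumes "w \<in> lists Gen" "f \<in> carrier G" "\<And>h l. Rho h l \<in> set w \<Longrightarrow> l < of_int x"
  shows "free_word (w @ [Delta f x]) \<approx> free_word (Delta (word_degree G w \<otimes> f) x # w)"
  using assms
proof (induction w rule: list.induct)
  case Nil
  then show ?case by simp
next
  case (Cons s w)
  have s: "s \<in> Gen" and w: "w \<in> lists Gen" and f: "f \<in> carrier G" using Cons.prems by auto
  define e where "e = word_degree G w \<otimes> f"
  have d: "word_degree G w \<in> H" using w by (rule word_degree_closed)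
  then have e: "e \<in> carrier G" using f by (simp add: e_def H_carrier)
  have "free_word (w @ [Delta f x]) \<approx> free_word (Delta e x # w)"
    unfolding e_def using w f Cons.prems(3) by (intro Cons.IH) auto
  from eqv_word_context[OF this, of "[s]" "[]"] s
  have "free_word ((s # w) @ [Delta f x]) \<approx> free_word ([s, Delta e x] @ w)" by simp
  \<comment> \<open>A \<open>Delta\<close> letter has degree one, so both kinds of letter fit the
    same exchange formula.\<close>
  also have swap: "free_word [s, Delta e x] \<approx> free_word [Delta (gen_degree G s \<otimes> e) x, s]"
  proof (cases s)
    case (Delta g y)
    then show ?thesis using delta_commute[of g e y x] s e by simp
  next
    case (Rho h l)
    then show ?thesis using rho_delta_less[of h e l x] s e Cons.prems(3)[of h l] by simp
  qed
  from eqv_word_context[OF this, of "[]" w] w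
  have "free_word ([s, Delta e x] @ w) \<approx> free_word ([Delta (gen_degree G s \<otimes> e) x, s] @ w)" by simp
  also have "gen_degree G s \<otimes> e = word_degree G (s # w) \<otimes> f"
    using s d f by (cases s) (auto simp: e_def H_carrier m_assoc)
  finally show ?case by simp
qed

lemma mult_eq_self:
  assumes "g \<in> carrier G" "x \<in> carrier G"
  shows "g \<otimes> x = x \<longleftrightarrow> g = \<one>" and "x = g \<otimes> x \<longleftrightarrow> g = \<one>"
proof -
  show "g \<otimes> x = x \<longleftrightarrow> g = \<one>"
    using right_cancel[of x g \<one>] assms by simp
  then show "x = g \<otimes> x \<longleftrightarrow> g = \<one>" by (auto dest: sym)
qed

text \<open>After \<open>word_delta\<close>, two deltas at one site meet with indices
  \<open>f\<close> and \<open>?d \<otimes> f\<close>, which agree exactly when the degree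
  \<open>?d\<close> is trivial; in that case the sum over \<open>f\<close> gives the unit.\<close>

lemma compress_word:
  assumes w: "w \<in> lists Gen" and x: "\<And>h l. Rho h l \<in> set w \<Longrightarrow> l < of_int x"
  shows "(\<Sum>f\<in>carrier G. fdelta f x * free_word w * fdelta f x) \<approx> free_neutral G (free_word w)"
proof -
  let ?d = "word_degree G w"
  have d: "?d \<in> carrier G" using word_degree_closed[OF w] by (rule H_carrier)
  have "fdelta f x * free_word w * fdelta f x \<approx> (if ?d = \<one> then fdelta f x else 0) * free_word w"
    if f: "f \<in> carrier G" for f
  proof -
    have "free_word ([Delta f x] @ (w @ [Delta f x]) @ [])
        \<approx> free_word ([Delta f x] @ (Delta (?d \<otimes> f) x # w) @ [])"
      using w f x by (intro eqv_word_context word_delta) auto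
    also have "\<dots> = free_word ([] @ [Delta f x, Delta (?d \<otimes> f) x] @ w)" by simp
    also have "\<dots> \<approx> free_word [] * (if f = ?d \<otimes> f then fdelta f x else 0) * free_word w"
      using w f d by (intro eqv_context delta_delta) auto
    also have "f = ?d \<otimes> f \<longleftrightarrow> ?d = \<one>"
      using d f by (rule mult_eq_self)
    finally show ?thesis by (simp add: free_word_append)
  qed
  then have "(\<Sum>f\<in>carrier G. fdelta f x * free_word w * fdelta f x)
      \<approx> (\<Sum>f\<in>carrier G. (if ?d = \<one> then fdelta f x else 0) * free_word w)"
    by (rule eqv_sum)
  also have "\<dots> = (if ?d = \<one> then (\<Sum>f\<in>carrier G. fdelta f x) else 0) * free_word w"
    by (simp add: sum_distrib_right)
  also have "\<dots> \<approx> (if ?d = \<one> then 1 else 0) * free_word w"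
    using w sum_delta[of x] by (intro eqv_mult) auto
  also have "\<dots> = free_neutral G (free_word w)" by simp
  finally show ?thesis .
qed

lemma neutral_compression:
  assumes "p \<in> carrier F"
  shows "\<exists>x. (\<Sum>f\<in>carrier G. fdelta f x * p * fdelta f x) \<approx> free_neutral G p"
proof -
  let ?P = "\<lambda>x p. (\<Sum>f\<in>carrier G. fdelta f x * p * fdelta f x) \<approx> free_neutral G p"
  \<comment> \<open>All sufficiently large sites are claimed at once, so that a common one is
    available for a sum of two elements.\<close>
  have "\<exists>x0. \<forall>x\<ge>x0. ?P x p"
    using assms
  proof (induction p rule: F_induct)
    case zero
    show ?case by (simp add: free_neutral_linear)
  next
    case (word c w)
    \<comment> \<open>A word has finitely many letters, so some site lies to the right of all its
      \<open>Rho\<close> letters.\<close>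
    have "\<exists>x0. \<forall>h l. Rho h l \<in> set w \<longrightarrow> l < of_int x0"
    proof (induction w)
      case (Cons s w)
      then obtain x0 where x0: "\<And>h l. Rho h l \<in> set w \<Longrightarrow> l < of_int x0" by blast
      obtain x1 where x1: "\<And>h l. s = Rho h l \<Longrightarrow> l < of_int x1"
      proof (cases s)
        case (Rho h l)
        with ex_less_of_int[of l] that show ?thesis by auto
      qed auto
      have "\<forall>h l. Rho h l \<in> set (s # w) \<longrightarrow> l < of_int (max x0 x1)"
        using x0 x1 by (force simp: of_int_max less_max_iff_disj)
      then show ?case by blast
    qed simp
    then obtain x0 where x0: "\<And>h l. Rho h l \<in> set w \<Longrightarrow> l < of_int x0" by blast
    have "?P x (free_scale c (free_word w))" if "x \<ge> x0" for x
    proof -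
      have "l < of_int x" if "Rho h l \<in> set w" for h l
        using x0[OF that] \<open>x0 \<le> x\<close> by (meson of_int_le_iff order_less_le_trans)
      from eqv_scale[OF compress_word[OF word this], where c = c] show ?thesis
        by (simp only: free_scale_sum free_scale_mult_left free_scale_mult_right free_neutral_linear)
    qed
    then show ?case by blast
  next
    case (add p q)
    then obtain x0 x1 where "\<And>x. x \<ge> x0 \<Longrightarrow> ?P x p" "\<And>x. x \<ge> x1 \<Longrightarrow> ?P x q" by blast
    then have "\<forall>x\<ge>max x0 x1. ?P x (p + q)"
      by (auto simp: distrib_left distrib_right sum.distrib free_neutral_linear intro: eqv_add)
    then show ?case by blast
  qed
  then show ?thesis by blast
qed

lemma I_sum: "(\<And>i. i \<in> S \<Longrightarrow> p i \<in> I) \<Longrightarrow> sum p S \<in> I"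
  by (induction S rule: infinite_finite_induct) (auto simp: I_zero I_add)

text \<open>The compression formula expresses the neutral part, modulo \<open>I\<close>, by
  two-sided multiples of \<open>p\<close>, which lie in \<open>I\<close> along with
  \<open>p\<close>.\<close>

lemma neutral_I:
  assumes "p \<in> I" shows "free_neutral G p \<in> I"
proof -
  obtain x where x: "(\<Sum>f\<in>carrier G. fdelta f x * p * fdelta f x) \<approx> free_neutral G p"
    using neutral_compression[OF I_subset[OF assms]] by blast
  have "(\<Sum>f\<in>carrier G. fdelta f x * p * fdelta f x) \<in> I"
    using assms by (intro I_sum I_mult_right I_mult_left) auto
  from I_add[OF this eqv_diff[OF eqv_sym[OF x]]] show ?thesis by simp
qed

lemma average_I: "p \<in> I \<Longrightarrow> free_average G p \<in> I"
  by (simp add: free_average_def I_scale I_sum shift_I neutral_I)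

section \<open>The quasi-basis identities modulo the relations\<close>

text \<open>The position \<open>l\<close> is just to the right of the site \<open>k\<close>, so both
  \<open>Rho\<close> letters commute with \<open>Delta b k\<close>; then the two deltas meet and the
  two \<open>Rho\<close> letters multiply.\<close>

lemma delta_rho_rho_delta:
  fixes k :: int
  assumes ab: "a \<in> carrier G" "b \<in> carrier G" and y: "y \<in> H" "y' \<in> H"
  defines "l \<equiv> of_int k + 1/2"
  shows "free_word [Delta a k, Rho y l, Rho y' l, Delta b k]
    \<approx> (if a = b then free_word [Delta a k, Rho (y \<otimes> y') l] else 0)"
proof -
  have l: "l \<in> half_ints" "l > of_int k" by (auto simp: l_def half_ints_def)
  have swap: "free_word [Rho h l, Delta b k] \<approx> free_word [Delta b k, Rho h l]" if "h \<in> H" for h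
    using that ab l by (intro rho_delta_greater)
  have "free_word [Delta a k, Rho y l, Rho y' l, Delta b k]
      \<approx> free_word [Delta a k, Rho y l, Delta b k, Rho y' l]"
    using eqv_word_context[OF swap[OF y(2)], of "[Delta a k, Rho y l]" "[]"] ab y l by simp
  also have "\<dots> \<approx> free_word [Delta a k, Delta b k, Rho y l, Rho y' l]"
    using eqv_word_context[OF swap[OF y(1)], of "[Delta a k]" "[Rho y' l]"] ab y l by simp
  also have "\<dots> \<approx> free_word [] * (if a = b then fdelta a k else 0) * free_word [Rho y l, Rho y' l]"
    using eqv_context[OF delta_delta[of a b k], of "[]" "[Rho y l, Rho y' l]"] ab y l by simp
  also have "\<dots> \<approx> free_word [] * (if a = b then fdelta a k else 0) * frho (y \<otimes> y') l"
    using ab y l by (intro eqv_mult[OF eqv_refl rho_rho]) auto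
  finally show ?thesis by (simp add: free_word_append split: if_splits)
qed

text \<open>The indices \<open>g \<otimes> x\<close> and \<open>x\<close> agree only for
  \<open>g = e\<close>, and then the \<open>Rho\<close> labels are mutually inverse. The two orders
  of the factors serve the left and the right quasi-basis identity.\<close>

lemma delta_rho_rho_delta_inverse:
  fixes k :: int
  assumes x: "x \<in> carrier G" and g: "g \<in> carrier G" and y: "y \<in> H"
  defines "l \<equiv> of_int k + 1/2"
  shows "free_word [Delta x k, Rho y l, Rho (g \<otimes> inv y \<otimes> inv g) l, Delta (g \<otimes> x) k]
      \<approx> (if g = \<one> then fdelta x k else 0)" (is ?A)
    and "free_word [Delta (g \<otimes> x) k, Rho (g \<otimes> inv y \<otimes> inv g) l, Rho y l, Delta x k]
      \<approx> (if g = \<one> then fdelta x k else 0)" (is ?B)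
proof -
  have l: "l \<in> half_ints" by (auto simp: l_def half_ints_def)
  have y': "g \<otimes> inv y \<otimes> inv g \<in> H" using g y by (intro conj_closed) auto
  have iff: "x = g \<otimes> x \<longleftrightarrow> g = \<one>" "g \<otimes> x = x \<longleftrightarrow> g = \<one>"
    using mult_eq_self[OF g x] by auto
  have one: "free_word [Delta x k, Rho \<one> l] \<approx> fdelta x k"
    using eqv_word_context[OF rho_one[OF l], of "[Delta x k]" "[]"] x by simp
  show ?A
    using delta_rho_rho_delta[of x "g \<otimes> x" y "g \<otimes> inv y \<otimes> inv g" k, folded l_def] x g y y' one
    by (cases "g = \<one>") (auto simp: iff H_carrier intro: eqv_trans)
  show ?B
    using delta_rho_rho_delta[of "g \<otimes> x" x "g \<otimes> inv y \<otimes> inv g" y k, folded l_def] x g y y' one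
    by (cases "g = \<one>") (auto simp: iff H_carrier intro: eqv_trans)
qed

section \<open>Representatives of the quasi-basis in the free algebra\<close>

definition basis_elem :: "int \<Rightarrow> 'a \<times> 'a \<Rightarrow> 'a free" where
  "basis_elem k = (\<lambda>(x, y). free_scale (complex_of_real (sqrt (real (order G))))
     (free_word [Delta x k, Rho y (of_int k + 1/2)]))"

lemma half_int [simp]: "of_int k + 1/2 \<in> half_ints"
  by (auto simp: half_ints_def)

lemma F_basis_elem [simp]: "i \<in> carrier G \<times> H \<Longrightarrow> basis_elem k i \<in> carrier F"
  by (auto simp: basis_elem_def simp del: free_scale_simps(5))

lemma order_ne_0: "(of_nat (order G) :: complex) \<noteq> 0"
  using order_gt_0_iff_finite finite_G by simp

lemma sqrt_order:
  "complex_of_real (sqrt (real (order G))) * complex_of_real (sqrt (real (order G))) = of_nat (order G)"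
  by (simp flip: of_real_mult)

lemma adj_basis_elem:
  "free_adj G (basis_elem k (x, y)) = free_scale (complex_of_real (sqrt (real (order G))))
     (free_word [Rho (inv y) (of_int k + 1/2), Delta x k])"
  by (simp add: basis_elem_def)

text \<open>The two square roots of the group order, one from the basis element and one from its
  adjoint, cancel the normalization of the average.\<close>

lemma average_basis_elem_left:
  "basis_elem k (x, y) * free_average G (free_adj G (basis_elem k (x, y)) * free_word w) =
    (if word_degree G (Rho (inv y) (of_int k + 1/2) # Delta x k # w) = \<one>
     then (\<Sum>g\<in>carrier G. free_word [Delta x k, Rho y (of_int k + 1/2)] *
       free_word (map (gen_shift G g) (Rho (inv y) (of_int k + 1/2) # Delta x k # w))) else 0)"
proof -
  let ?c = "complex_of_real (sqrt (real (order G)))"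
  let ?l = "of_int k + 1/2 :: rat"
  \<comment> \<open>The adjoint is rewritten before \<open>basis_elem\<close> is unfolded, since
    \<open>adj_basis_elem\<close> matches only the folded form.\<close>
  have "basis_elem k (x, y) * free_average G (free_adj G (basis_elem k (x, y)) * free_word w) =
      free_scale (?c * ?c) (free_word [Delta x k, Rho y ?l] *
        free_average G (free_word (Rho (inv y) ?l # Delta x k # w)))"
    by (simp only: adj_basis_elem) (simp only: basis_elem_def prod.case free_scale_mult_left
        free_scale_mult_right free_average_linear free_scale_simps(4) free_word_append append_Cons append_Nil)
  then show ?thesis
    by (simp only: sqrt_order free_average_word mult_zero_right free_scale_simps(1)
        free_scale_mult_right sum_distrib_left free_scale_simps(3,4)
        order_ne_0 nonzero_mult_div_cancel_left mult_1_right times_divide_eq_right divide_self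
        not_False_eq_True split: if_split) simp
qed

lemma average_basis_elem_right:
  "free_average G (free_word w * basis_elem k (x, y)) * free_adj G (basis_elem k (x, y)) =
    (if word_degree G (w @ [Delta x k, Rho y (of_int k + 1/2)]) = \<one>
     then (\<Sum>g\<in>carrier G. free_word (map (gen_shift G g) (w @ [Delta x k, Rho y (of_int k + 1/2)])) *
       free_word [Rho (inv y) (of_int k + 1/2), Delta x k]) else 0)"
proof -
  let ?c = "complex_of_real (sqrt (real (order G)))"
  let ?l = "of_int k + 1/2 :: rat"
  have "free_average G (free_word w * basis_elem k (x, y)) * free_adj G (basis_elem k (x, y)) =
      free_scale (?c * ?c) (free_average G (free_word (w @ [Delta x k, Rho y ?l])) *
        free_word [Rho (inv y) ?l, Delta x k])"
    by (simp only: adj_basis_elem) (simp only: basis_elem_def prod.case free_scale_mult_left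
        free_scale_mult_right free_average_linear free_scale_simps(4) free_word_append append_Cons append_Nil)
  then show ?thesis
    by (simp only: sqrt_order free_average_word mult_zero_left free_scale_simps(1)
        free_scale_mult_left sum_distrib_right free_scale_simps(3,4)
        order_ne_0 nonzero_mult_div_cancel_left mult_1_right times_divide_eq_right divide_self
        not_False_eq_True split: if_split) simp
qed

text \<open>The averaged word has degree \<open>inv y\<close> times that of \<open>w\<close>, which
  selects a single \<open>y\<close>; the letters at \<open>k\<close> then select
  \<open>g = e\<close>, leaving the sum of all \<open>Delta x k\<close> in front of
  \<open>w\<close>.\<close>

lemma quasi_basis_word_left:
  assumes w: "w \<in> lists Gen"
  shows "(\<Sum>i\<in>carrier G \<times> H. basis_elem k i * free_average G (free_adj G (basis_elem k i) * free_word w))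
    \<approx> free_word w"
proof -
  define l :: rat where "l = of_int k + 1/2"
  let ?d = "word_degree G w"
  have d: "?d \<in> H" using w by (rule word_degree_closed)
  have summand: "basis_elem k (x, y) * free_average G (free_adj G (basis_elem k (x, y)) * free_word w) =
      (if y = ?d then (\<Sum>g\<in>carrier G. free_word [Delta x k, Rho y l,
        Rho (g \<otimes> inv y \<otimes> inv g) l, Delta (g \<otimes> x) k] * free_word (map (gen_shift G g) w)) else 0)"
    if "x \<in> carrier G" "y \<in> H" for x y
  proof -
    have deg: "word_degree G (Rho (inv y) l # Delta x k # w) = \<one> \<longleftrightarrow> y = ?d"
      using that d inv_solve_left'[of \<one> y ?d] by (auto simp: H_carrier)
    have "free_word [Delta x k, Rho y l] *
       free_word (map (gen_shift G g) (Rho (inv y) l # Delta x k # w)) = free_word [Delta x k, Rho y l,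
        Rho (g \<otimes> inv y \<otimes> inv g) l, Delta (g \<otimes> x) k] * free_word (map (gen_shift G g) w)" for g
      by (simp add: free_word_append)
    then show ?thesis
      using average_basis_elem_left[of k x y w, folded l_def] by (simp only: deg)
  qed
  have "(\<Sum>i\<in>carrier G \<times> H. basis_elem k i * free_average G (free_adj G (basis_elem k i) * free_word w))
      = (\<Sum>x\<in>carrier G. \<Sum>y\<in>H. if y = ?d then (\<Sum>g\<in>carrier G. free_word [Delta x k, Rho y l,
        Rho (g \<otimes> inv y \<otimes> inv g) l, Delta (g \<otimes> x) k] * free_word (map (gen_shift G g) w)) else 0)"
    unfolding sum.cartesian_product
    by (rule sum.cong[OF refl]) (clarify, simp only: summand prod.case)
  also have "\<dots> = (\<Sum>x\<in>carrier G. \<Sum>g\<in>carrier G. free_word [Delta x k, Rho ?d l,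
        Rho (g \<otimes> inv ?d \<otimes> inv g) l, Delta (g \<otimes> x) k] * free_word (map (gen_shift G g) w))"
    using d finite_H by simp
  \<comment> \<open>The four letters in front are the product treated in
    \<open>delta_rho_rho_delta_inverse\<close>, which removes every term with \<open>g\<close>
    different from the unit.\<close>
  also have "\<dots> \<approx> (\<Sum>x\<in>carrier G. \<Sum>g\<in>carrier G.
      (if g = \<one> then fdelta x k else 0) * free_word (map (gen_shift G g) w))"
    using w d by (intro eqv_sum eqv_mult delta_rho_rho_delta_inverse(1)[where k = k, folded l_def] eqv_refl F_single map_gen_shift_in)
  also have "\<dots> = (\<Sum>x\<in>carrier G. \<Sum>g\<in>carrier G. if g = \<one> then fdelta x k * free_word w else 0)"
    using w by (intro sum.cong refl) (auto simp: map_shift_one)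
  also have "\<dots> = (\<Sum>x\<in>carrier G. fdelta x k) * free_word w"
    using finite_G by (simp add: sum_distrib_right)
  also have "\<dots> \<approx> 1 * free_word w"
    using w by (intro eqv_mult sum_delta) auto
  finally show ?thesis by simp
qed

text \<open>Here the averaged word has the degree of \<open>w\<close> times \<open>y\<close>, so the
  surviving \<open>y\<close> is the inverse of that degree; the sum of all \<open>Delta x k\<close>
  ends up behind \<open>w\<close>.\<close>

lemma quasi_basis_word_right:
  assumes w: "w \<in> lists Gen"
  shows "(\<Sum>i\<in>carrier G \<times> H. free_average G (free_word w * basis_elem k i) * free_adj G (basis_elem k i))
    \<approx> free_word w"
proof -
  define l :: rat where "l = of_int k + 1/2"
  let ?d = "inv (word_degree G w)"
  have dw: "word_degree G w \<in> H" using w by (rule word_degree_closed)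
  then have d: "?d \<in> H" by simp
  have l: "l \<in> half_ints" by (simp add: l_def)
  have summand: "free_average G (free_word w * basis_elem k (x, y)) * free_adj G (basis_elem k (x, y)) =
      (if y = ?d then (\<Sum>g\<in>carrier G. free_word (map (gen_shift G g) w) * free_word [Delta (g \<otimes> x) k,
        Rho (g \<otimes> y \<otimes> inv g) l, Rho (inv y) l, Delta x k]) else 0)"
    if "x \<in> carrier G" "y \<in> H" for x y
  proof -
    have "word_degree G (w @ [Delta x k, Rho y l]) = word_degree G w \<otimes> y"
      using that dw w l by (subst word_degree_append) (auto simp: H_carrier)
    then have deg: "word_degree G (w @ [Delta x k, Rho y l]) = \<one> \<longleftrightarrow> y = ?d"
      using that dw inv_solve_left'[of \<one> ?d y] by (simp add: H_carrier)
    have "free_word (map (gen_shift G g) (w @ [Delta x k, Rho y l])) *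
       free_word [Rho (inv y) l, Delta x k] = free_word (map (gen_shift G g) w) *
       free_word [Delta (g \<otimes> x) k, Rho (g \<otimes> y \<otimes> inv g) l, Rho (inv y) l, Delta x k]" for g
      by (simp add: free_word_append)
    then show ?thesis
      using average_basis_elem_right[of w k x y, folded l_def] by (simp only: deg)
  qed
  have "(\<Sum>i\<in>carrier G \<times> H. free_average G (free_word w * basis_elem k i) * free_adj G (basis_elem k i))
      = (\<Sum>x\<in>carrier G. \<Sum>y\<in>H. if y = ?d then (\<Sum>g\<in>carrier G. free_word (map (gen_shift G g) w) *
        free_word [Delta (g \<otimes> x) k, Rho (g \<otimes> y \<otimes> inv g) l, Rho (inv y) l, Delta x k]) else 0)"
    unfolding sum.cartesian_product
    by (rule sum.cong[OF refl]) (clarify, simp only: summand prod.case)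
  also have "\<dots> = (\<Sum>x\<in>carrier G. \<Sum>g\<in>carrier G. free_word (map (gen_shift G g) w) * free_word
      [Delta (g \<otimes> x) k, Rho (g \<otimes> inv (word_degree G w) \<otimes> inv g) l, Rho (word_degree G w) l, Delta x k])"
    using d dw finite_H by (simp add: H_carrier)
  \<comment> \<open>The second product formula applies with the degree of \<open>w\<close> in the
    role of \<open>y\<close>.\<close>
  also have "\<dots> \<approx> (\<Sum>x\<in>carrier G. \<Sum>g\<in>carrier G.
      free_word (map (gen_shift G g) w) * (if g = \<one> then fdelta x k else 0))"
    using w dw by (intro eqv_sum eqv_mult delta_rho_rho_delta_inverse(2)[where k = k, folded l_def] eqv_refl F_single map_gen_shift_in)
  also have "\<dots> = (\<Sum>x\<in>carrier G. \<Sum>g\<in>carrier G. if g = \<one> then free_word w * fdelta x k else 0)"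
    using w by (intro sum.cong refl) (auto simp: map_shift_one)
  also have "\<dots> = free_word w * (\<Sum>x\<in>carrier G. fdelta x k)"
    using finite_G by (simp add: sum_distrib_left)
  also have "\<dots> \<approx> free_word w * 1"
    using w by (intro eqv_mult sum_delta) auto
  finally show ?thesis by simp
qed

text \<open>Both left-hand sides are linear in \<open>p\<close>, so the identities for words
  suffice.\<close>

lemma quasi_basis_free:
  assumes "p \<in> carrier F"
  shows "(\<Sum>i\<in>carrier G \<times> H. basis_elem k i * free_average G (free_adj G (basis_elem k i) * p)) \<approx> p" (is "?L p \<approx> p")
    and "(\<Sum>i\<in>carrier G \<times> H. free_average G (p * basis_elem k i) * free_adj G (basis_elem k i)) \<approx> p" (is "?R p \<approx> p")
proof -
  show "?L p \<approx> p"
    using assms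
  proof (induction p rule: F_induct)
    case (word c w)
    from eqv_scale[OF quasi_basis_word_left[OF word], of c k] show ?case
      by (simp only: free_scale_sum free_scale_mult_right free_average_linear)
  next
    case (add p q)
    from eqv_add[OF add.IH] show ?case
      by (simp only: distrib_left free_average_linear sum.distrib)
  qed (simp add: free_average_linear)
  show "?R p \<approx> p"
    using assms
  proof (induction p rule: F_induct)
    case (word c w)
    from eqv_scale[OF quasi_basis_word_right[OF word], of c k] show ?case
      by (simp only: free_scale_sum free_scale_mult_left free_average_linear)
  next
    case (add p q)
    from eqv_add[OF add.IH] show ?case
      by (simp only: distrib_right free_average_linear sum.distrib)
  qed (simp add: free_average_linear)
qed

section \<open>The local algebra and its norm\<close>

abbreviation "L \<equiv> local_algebra G H"

definition local_class :: "'a free \<Rightarrow> 'a free set" where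
  "local_class p = I +>\<^bsub>F\<^esub> p"

lemma star_ring_L: "star_ring L"
  unfolding local_algebra_def by (rule star_ideal.star_ring_quotient[OF star_ideal_I])

lemma L_carrier: "carrier L = local_class ` carrier F"
  unfolding local_algebra_def by (auto simp: star_ideal.carrier_quotient[OF star_ideal_I] local_class_def)

lemma local_class_closed [simp]: "p \<in> carrier F \<Longrightarrow> local_class p \<in> carrier L"
  by (simp add: L_carrier)

lemma local_class_zero: "\<zero>\<^bsub>L\<^esub> = local_class 0"
  using star_ideal.quotient_zero[OF star_ideal_I] by (simp add: local_class_def local_algebra_def)

lemma local_class_add: "\<lbrakk>p \<in> carrier F; q \<in> carrier F\<rbrakk> \<Longrightarrow> local_class p \<oplus>\<^bsub>L\<^esub> local_class q = local_class (p + q)"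
  using star_ideal.quotient_add[OF star_ideal_I, of p q] by (simp add: local_class_def local_algebra_def)

lemma local_class_mult: "\<lbrakk>p \<in> carrier F; q \<in> carrier F\<rbrakk> \<Longrightarrow> local_class p \<otimes>\<^bsub>L\<^esub> local_class q = local_class (p * q)"
  using star_ideal.quotient_mult[OF star_ideal_I, of p q] by (simp add: local_class_def local_algebra_def)

lemma local_class_smult: "p \<in> carrier F \<Longrightarrow> c \<odot>\<^bsub>L\<^esub> local_class p = local_class (free_scale c p)"
  using star_ideal.quotient_smult[OF star_ideal_I, of p c] by (simp add: local_class_def local_algebra_def)

lemma local_class_adj: "p \<in> carrier F \<Longrightarrow> adj L (local_class p) = local_class (free_adj G p)"
  using star_ideal.quotient_adj[OF star_ideal_I, of p] by (simp add: local_class_def local_algebra_def)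

lemma local_class_eqI: "p \<approx> q \<Longrightarrow> local_class p = local_class q"
  using star_ideal.coset_eq_iff[OF star_ideal_I, of p q] by (simp add: local_class_def eqv_def F_minus)

lemma induced_map_local_class:
  assumes "\<And>p. p \<in> carrier F \<Longrightarrow> f p \<in> carrier F"
    and "\<And>p q. \<lbrakk>p \<in> carrier F; q \<in> carrier F\<rbrakk> \<Longrightarrow> f (p + q) = f p + f q"
    and "\<And>p. p \<in> I \<Longrightarrow> f p \<in> I" and "p \<in> carrier F"
  shows "induced_map F I f (local_class p) = local_class (f p)"
proof -
  interpret ideal I F by (rule ideal_I)
  have "induced_map F I f (I +>\<^bsub>F\<^esub> p) = I +>\<^bsub>F\<^esub> f p"
    by (rule induced_map_coset) (use assms in auto)
  then show ?thesis by (simp only: local_class_def)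
qed

text \<open>The average maps \<open>I\<close> into itself by \<open>average_I\<close>, hence
  descends to the quotient.\<close>

lemma local_act_local_class:
  assumes "p \<in> carrier F"
  shows "local_act G H (z_double G) (local_class p) = local_class (free_average G p)"
proof -
  have "induced_map F I (free_act G H (z_double G)) (local_class p) = local_class (free_act G H (z_double G) p)"
    by (rule induced_map_local_class) (use assms in \<open>auto simp: free_act_z free_average_linear average_I I_subset\<close>)
  then show ?thesis using assms by (simp add: local_act_def free_act_z)
qed

lemma local_shift_local_class:
  "\<lbrakk>p \<in> carrier F; g \<in> carrier G\<rbrakk> \<Longrightarrow> induced_map F I (free_shift G g) (local_class p) = local_class (free_shift G g p)"
  by (rule induced_map_local_class) (auto simp: free_shift_linear shift_I)

section \<open>Estimates for the largest C*-seminorm\<close>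

lemma free_adj_shift:
  assumes p: "p \<in> carrier F" and g: "g \<in> carrier G"
  shows "free_adj G (free_shift G g p) = free_shift G g (free_adj G p)"
  using p
proof (induction p rule: F_induct)
  case (word c w)
  have "gen_adj G (gen_shift G g s) = gen_shift G g (gen_adj G s)" if "s \<in> Gen" for s
    using that g by (cases s) (auto simp: H_carrier group_simps)
  then have "map (gen_adj G) (map (gen_shift G g) w) = map (gen_shift G g) (map (gen_adj G) w)"
    using word by auto
  then have "free_word (rev (map (gen_adj G) (map (gen_shift G g) w)))
      = free_word (map (gen_shift G g) (rev (map (gen_adj G) w)))"
    by (simp only: rev_map)
  then have "free_adj G (free_shift G g (free_word w)) = free_shift G g (free_adj G (free_word w))"
    by (simp only: free_shift_word free_adj_single complex_cnj_one)
  \<comment> \<open>A scalar is a multiple of the empty word: reversal puts its conjugate on the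
    right, and centrality moves it back.\<close>
  moreover have "free_adj G (free_scale c q) = free_scale (cnj c) (free_adj G q)" for q
    by (simp add: free_scale_def free_adj_mult)
      (use free_scale_mult_right[of "free_adj G q" "cnj c" "1"] in
        \<open>simp add: free_one free_scale_def[symmetric] del: single_one\<close>)
  ultimately show ?case by (simp only: free_shift_linear)
qed (auto simp: free_adj_add free_shift_linear)

text \<open>Composing a C*-seminorm with a *-homomorphism gives a C*-seminorm. Since
  \<open>env_norm\<close> is the supremum over all of them, a shift cannot increase it.\<close>

lemma cstar_seminorm_shift:
  assumes p: "cstar_seminorm L p" and g: "g \<in> carrier G"
  shows "cstar_seminorm L (\<lambda>X. p (induced_map F I (free_shift G g) X))"
  using p unfolding cstar_seminorm_def L_carrier
  by (simp add: local_class_add local_class_smult local_class_mult local_class_adj local_shift_local_class g free_shift_linear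
      free_shift_mult free_adj_shift[symmetric])

text \<open>By the C*-identity a projection has seminorm 0 or 1, and a unitary has the unit's
  seminorm as its square; submultiplicativity extends the bound from letters to words.\<close>

lemma seminorm_word:
  assumes p: "cstar_seminorm L p" and w: "w \<in> lists Gen"
  shows "p (local_class (free_word w)) \<le> 1"
proof -
  have nn: "0 \<le> p (local_class q)" if "q \<in> carrier F" for q
    using p that by (auto simp: cstar_seminorm_def)
  have cs: "(p (local_class q))\<^sup>2 = p (local_class (free_adj G q * q))" if "q \<in> carrier F" for q
  proof -
    have "p (adj L (local_class q) \<otimes>\<^bsub>L\<^esub> local_class q) = (p (local_class q))\<^sup>2"
      using p that by (simp add: cstar_seminorm_def)
    then show ?thesis using that by (simp add: local_class_adj local_class_mult)
  qed
  have sq: "t \<le> 1" if "t\<^sup>2 \<le> 1" for t :: real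
    using that power2_le_imp_le[of t 1] by simp
  \<comment> \<open>The C*-identity takes this form for the unit and for the projections
    \<open>Delta\<close>.\<close>
  have idem: "t \<le> 1" if "t\<^sup>2 = t" for t :: real
    using that by (cases "t = 0") (auto simp: power2_eq_square)
  have one: "p (local_class (free_word [])) \<le> 1"
    by (rule idem) (use cs[of "free_word []"] in simp)
  have letter: "p (local_class (free_word [s])) \<le> 1" if s: "s \<in> Gen" for s
  proof (cases s)
    case (Delta g x)
    then have "local_class (free_adj G (free_word [s]) * free_word [s]) = local_class (free_word [s])"
      using s delta_delta[of g g x] by (intro local_class_eqI) (simp add: free_word_append)
    then show ?thesis using cs[of "free_word [s]"] s by (intro idem) simp
  next
    case (Rho h l)
    then have h: "h \<in> H" "l \<in> half_ints" using s by auto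
    have "free_word [Rho (inv h) l, Rho h l] \<approx> frho \<one> l"
      using rho_rho[of "inv h" h l] h by (simp add: H_carrier)
    then have "free_word [Rho (inv h) l, Rho h l] \<approx> free_word []"
      using rho_one[OF h(2)] by (rule eqv_trans)
    then have "local_class (free_word [Rho (inv h) l, Rho h l]) = local_class (free_word [])"
      by (rule local_class_eqI)
    moreover have "free_adj G (free_word [s]) * free_word [s] = free_word [Rho (inv h) l, Rho h l]"
      using Rho by (simp add: free_word_append)
    moreover have "free_word [s] \<in> carrier F" using s by simp
    ultimately have "(p (local_class (free_word [s])))\<^sup>2 \<le> 1" using cs[of "free_word [s]"] one by simp
    then show ?thesis by (rule sq)
  qed
  show ?thesis
    using w
  proof (induction w rule: list.induct)
    case Nil
    show ?case by (rule one)
  next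
    case (Cons s w)
    then have s: "s \<in> Gen" and w: "w \<in> lists Gen" by auto
    have "p (local_class (free_word (s # w))) = p (local_class (free_word [s]) \<otimes>\<^bsub>L\<^esub> local_class (free_word w))"
      using s w by (simp add: local_class_mult free_word_append)
    also have "\<dots> \<le> p (local_class (free_word [s])) * p (local_class (free_word w))"
      using p s w by (simp add: cstar_seminorm_def)
    also have "\<dots> \<le> 1 * 1"
      using letter[OF s] Cons.IH[OF w] nn s w by (intro mult_mono) auto
    finally show ?case by simp
  qed
qed

text \<open>Words are bounded by 1 in every C*-seminorm at once, so an element is bounded by the sum
  of the absolute values of its coefficients, independently of the seminorm.\<close>

lemma bounded_star_ring_L: "bounded_star_ring L"
proof -
  interpret L: star_ring L by (rule star_ring_L)
  have "\<exists>B. \<forall>p. cstar_seminorm L p \<longrightarrow> p (local_class q) \<le> B" if "q \<in> carrier F" for q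
    using that
  proof (induction q rule: F_induct)
    case zero
    have "p (local_class 0) \<le> 0" if "cstar_seminorm L p" for p
    proof -
      have "p (0 \<odot>\<^bsub>L\<^esub> local_class 0) = cmod 0 * p (local_class 0)"
        using that by (simp only: cstar_seminorm_def local_class_closed F_zero)
      then show ?thesis by (simp add: local_class_smult)
    qed
    then show ?case by blast
  next
    case (word c w)
    have "p (local_class (free_scale c (free_word w))) \<le> cmod c" if p: "cstar_seminorm L p" for p
    proof -
      have "p (c \<odot>\<^bsub>L\<^esub> local_class (free_word w)) = cmod c * p (local_class (free_word w))"
        using p word by (simp only: cstar_seminorm_def local_class_closed F_single)
      moreover have "cmod c * p (local_class (free_word w)) \<le> cmod c * 1"
        using seminorm_word[OF p word] by (intro mult_left_mono) auto
      ultimately show ?thesis using word by (simp only: local_class_smult F_single mult_1_right)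
    qed
    then show ?case by blast
  next
    case (add q r)
    then obtain B B' where B: "\<And>p. cstar_seminorm L p \<Longrightarrow> p (local_class q) \<le> B"
      "\<And>p. cstar_seminorm L p \<Longrightarrow> p (local_class r) \<le> B'" by blast
    have "p (local_class (q + r)) \<le> B + B'" if p: "cstar_seminorm L p" for p
    proof -
      have "p (local_class q \<oplus>\<^bsub>L\<^esub> local_class r) \<le> p (local_class q) + p (local_class r)"
        using p add.hyps by (simp only: cstar_seminorm_def local_class_closed)
      then show ?thesis using B(1)[OF p] B(2)[OF p] add.hyps by (simp add: local_class_add)
    qed
    then show ?case by blast
  qed
  then show ?thesis
    by unfold_locales (auto simp: L_carrier bdd_above_def)
qed

lemma env_norm_word:
  assumes "w \<in> lists Gen" shows "env_norm L (local_class (free_word w)) \<le> 1"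
  using bounded_star_ring.env_norm_le[OF bounded_star_ring_L] seminorm_word[OF _ assms] by blast

lemma env_norm_shift:
  assumes "p \<in> carrier F" "g \<in> carrier G"
  shows "env_norm L (local_class (free_shift G g p)) \<le> env_norm L (local_class p)"
proof (rule bounded_star_ring.env_norm_le[OF bounded_star_ring_L])
  fix q assume "cstar_seminorm L q"
  from bounded_star_ring.seminorm_le_env_norm[OF bounded_star_ring_L cstar_seminorm_shift[OF this assms(2)], of "local_class p"]
  show "q (local_class (free_shift G g p)) \<le> env_norm L (local_class p)"
    using assms by (simp add: local_shift_local_class)
qed

lemma env_norm_sum:
  assumes "\<And>i. i \<in> S \<Longrightarrow> p i \<in> carrier F"
  shows "env_norm L (local_class (sum p S)) \<le> (\<Sum>i\<in>S. env_norm L (local_class (p i)))"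
proof -
  interpret L: bounded_star_ring L by (rule bounded_star_ring_L)
  have z: "env_norm L (local_class 0) = 0" using L.env_norm_zero by (simp add: local_class_zero)
  show ?thesis
    using assms
  proof (induction S rule: infinite_finite_induct)
    case (insert i S)
    have "env_norm L (local_class (p i) \<oplus>\<^bsub>L\<^esub> local_class (sum p S)) \<le> env_norm L (local_class (p i)) + env_norm L (local_class (sum p S))"
      using insert.prems by (intro L.env_norm_triangle local_class_closed F_sum) auto
    also have "local_class (p i) \<oplus>\<^bsub>L\<^esub> local_class (sum p S) = local_class (sum p (insert i S))"
      using insert.prems insert.hyps by (subst local_class_add) (auto intro!: F_sum)
    finally show ?case using insert.IH insert.prems insert.hyps by fastforce
  qed (simp_all add: z)
qed

text \<open>Compression writes the neutral part as \<open>order G\<close> terms of norm at most that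
  of \<open>p\<close>, and averaging the shifts costs nothing. The site \<open>x\<close> depends on
  \<open>p\<close> but the constant does not, as the extension to the completion requires.\<close>

lemma env_norm_average:
  assumes p: "p \<in> carrier F"
  shows "env_norm L (local_class (free_average G p)) \<le> real (order G) * env_norm L (local_class p)"
proof -
  interpret L: bounded_star_ring L by (rule bounded_star_ring_L)
  let ?E = "free_neutral G p" and ?n = "real (order G)"
  have n: "?n > 0" using order_gt_0_iff_finite finite_G by simp
  obtain x where x: "(\<Sum>f\<in>carrier G. fdelta f x * p * fdelta f x) \<approx> ?E"
    using neutral_compression[OF p] by blast
  have E: "env_norm L (local_class ?E) \<le> ?n * env_norm L (local_class p)"
  proof -
    have "env_norm L (local_class ?E) \<le> (\<Sum>f\<in>carrier G. env_norm L (local_class (fdelta f x * p * fdelta f x)))"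
      unfolding local_class_eqI[OF x, symmetric] using p by (intro env_norm_sum) auto
    also have "\<dots> \<le> (\<Sum>f\<in>carrier G. env_norm L (local_class p))"
    proof (rule sum_mono)
      fix f assume f: "f \<in> carrier G"
      have d: "env_norm L (local_class (fdelta f x)) \<le> 1" "0 \<le> env_norm L (local_class (fdelta f x))"
        "0 \<le> env_norm L (local_class p)"
        using f p by (auto intro!: env_norm_word L.env_norm_nonneg)
      have "env_norm L (local_class (fdelta f x * p * fdelta f x))
          \<le> env_norm L (local_class (fdelta f x * p)) * env_norm L (local_class (fdelta f x))"
        using L.env_norm_mult[of "local_class (fdelta f x * p)" "local_class (fdelta f x)"] p f by (simp add: local_class_mult)
      also have "\<dots> \<le> (env_norm L (local_class (fdelta f x)) * env_norm L (local_class p)) * env_norm L (local_class (fdelta f x))"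
        using L.env_norm_mult[of "local_class (fdelta f x)" "local_class p"] p f d
        by (intro mult_right_mono) (simp_all add: local_class_mult)
      also have "\<dots> \<le> (1 * env_norm L (local_class p)) * 1"
        using d by (intro mult_mono) auto
      finally show "env_norm L (local_class (fdelta f x * p * fdelta f x)) \<le> env_norm L (local_class p)" by simp
    qed
    finally show ?thesis by (simp add: order_def)
  qed
  have "env_norm L (local_class (free_average G p))
      \<le> cmod (1 / of_nat (order G)) * env_norm L (local_class (\<Sum>g\<in>carrier G. free_shift G g ?E))"
    using L.env_norm_smult_le[of "local_class (\<Sum>g\<in>carrier G. free_shift G g ?E)" "1 / of_nat (order G)"] p
    by (simp add: free_average_def local_class_smult)
  also have "\<dots> \<le> cmod (1 / of_nat (order G)) * (\<Sum>g\<in>carrier G. env_norm L (local_class (free_shift G g ?E)))"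
    using p by (intro mult_left_mono env_norm_sum) auto
  also have "\<dots> \<le> cmod (1 / of_nat (order G)) * (\<Sum>g\<in>carrier G. env_norm L (local_class ?E))"
    using p by (intro mult_left_mono sum_mono env_norm_shift) auto
  also have "\<dots> = env_norm L (local_class ?E)" using n by (simp add: order_def norm_divide)
  finally show ?thesis using E by simp
qed

section \<open>Passage to the completion\<close>

abbreviation "A \<equiv> field_algebra G H"
abbreviation "C \<equiv> cauchy_algebra L"
abbreviation "\<Gamma> \<equiv> field_act G H (z_double G)"

text \<open>Elements of the field algebra are handled through sequences of representatives in the free
  algebra, so that all operations become termwise operations of type \<open>'a free\<close>.\<close>

definition field_class :: "(nat \<Rightarrow> 'a free) \<Rightarrow> 'a field_elem" where
  "field_class p = null_sequences L +>\<^bsub>C\<^esub> (\<lambda>n. local_class (p n))"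

text \<open>The Cauchy condition is imposed on the local classes, as the norm is available only
  there.\<close>

definition cauchy_reps :: "(nat \<Rightarrow> 'a free) set" where
  "cauchy_reps = {p. (\<forall>n. p n \<in> carrier F) \<and> (\<lambda>n. local_class (p n)) \<in> carrier C}"

lemma cauchy_repsD: "p \<in> cauchy_reps \<Longrightarrow> p n \<in> carrier F" "p \<in> cauchy_reps \<Longrightarrow> (\<lambda>n. local_class (p n)) \<in> carrier C"
  by (auto simp: cauchy_reps_def)

lemma star_ideal_null_L: "star_ideal (null_sequences L) C"
  using bounded_star_ring.star_ideal_null[OF bounded_star_ring_L] .

lemma star_ring_A: "star_ring A"
  unfolding field_algebra_def cstar_completion_def
  by (rule star_ideal.star_ring_quotient[OF star_ideal_null_L])

lemmas cauchy_simps_L [simp] = bounded_star_ring.cauchy_simps[OF bounded_star_ring_L]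

text \<open>A representative in the free algebra is chosen separately for each term of a Cauchy
  sequence of local classes.\<close>

lemma A_carrier: "carrier A = field_class ` cauchy_reps"
proof -
  have "carrier C \<subseteq> (\<lambda>p n. local_class (p n)) ` cauchy_reps"
  proof
    fix s assume s: "s \<in> carrier C"
    then have "\<forall>n. \<exists>p\<in>carrier F. s n = local_class p"
      using bounded_star_ring.cauchyD[OF bounded_star_ring_L] L_carrier by blast
    then obtain p where p: "\<And>n. p n \<in> carrier F" "\<And>n. s n = local_class (p n)" by metis
    then have s': "s = (\<lambda>n. local_class (p n))" by auto
    then have "p \<in> cauchy_reps" using s p by (auto simp: cauchy_reps_def)
    then show "s \<in> (\<lambda>p n. local_class (p n)) ` cauchy_reps" using s' by blast
  qed
  moreover have "(\<lambda>p n. local_class (p n)) ` cauchy_reps \<subseteq> carrier C" by (auto simp: cauchy_repsD)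
  ultimately have "carrier C = (\<lambda>p n. local_class (p n)) ` cauchy_reps" by blast
  then show ?thesis
    unfolding field_algebra_def cstar_completion_def star_ideal.carrier_quotient[OF star_ideal_null_L]
    by (auto simp: field_class_def)
qed

lemma cauchy_reps_const: "p \<in> carrier F \<Longrightarrow> (\<lambda>n. p) \<in> cauchy_reps"
  using bounded_star_ring.const_cauchy[OF bounded_star_ring_L, of "local_class p"] by (simp add: cauchy_reps_def)

lemma field_class_add:
  assumes "p \<in> cauchy_reps" "q \<in> cauchy_reps"
  shows "(\<lambda>n. p n + q n) \<in> cauchy_reps" and "field_class p \<oplus>\<^bsub>A\<^esub> field_class q = field_class (\<lambda>n. p n + q n)"
  using star_ideal.quotient_add[OF star_ideal_null_L cauchy_repsD(2)[OF assms(1)] cauchy_repsD(2)[OF assms(2)]]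
    bounded_star_ring.cauchy_add[OF bounded_star_ring_L cauchy_repsD(2)[OF assms(1)] cauchy_repsD(2)[OF assms(2)]] assms
  by (simp_all add: cauchy_reps_def field_class_def local_class_add field_algebra_def cstar_completion_def)

lemma field_class_mult:
  assumes "p \<in> cauchy_reps" "q \<in> cauchy_reps"
  shows "(\<lambda>n. p n * q n) \<in> cauchy_reps" and "field_class p \<otimes>\<^bsub>A\<^esub> field_class q = field_class (\<lambda>n. p n * q n)"
  using star_ideal.quotient_mult[OF star_ideal_null_L cauchy_repsD(2)[OF assms(1)] cauchy_repsD(2)[OF assms(2)]]
    bounded_star_ring.cauchy_mult[OF bounded_star_ring_L cauchy_repsD(2)[OF assms(1)] cauchy_repsD(2)[OF assms(2)]] assms
  by (simp_all add: cauchy_reps_def field_class_def local_class_mult field_algebra_def cstar_completion_def)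

lemma field_class_smult:
  assumes "p \<in> cauchy_reps"
  shows "c \<odot>\<^bsub>A\<^esub> field_class p = field_class (\<lambda>n. free_scale c (p n))"
  using star_ideal.quotient_smult[OF star_ideal_null_L cauchy_repsD(2)[OF assms], of c] assms
  by (simp add: cauchy_reps_def field_class_def local_class_smult field_algebra_def cstar_completion_def)

lemma field_class_adj:
  assumes "p \<in> cauchy_reps"
  shows "(\<lambda>n. free_adj G (p n)) \<in> cauchy_reps" and "adj A (field_class p) = field_class (\<lambda>n. free_adj G (p n))"
  using star_ideal.quotient_adj[OF star_ideal_null_L cauchy_repsD(2)[OF assms]]
    bounded_star_ring.cauchy_adj[OF bounded_star_ring_L cauchy_repsD(2)[OF assms]] assms
  by (simp_all add: cauchy_reps_def field_class_def local_class_adj field_algebra_def cstar_completion_def)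

lemma field_class_zero: "\<zero>\<^bsub>A\<^esub> = field_class (\<lambda>n. 0)"
  using star_ideal.quotient_zero[OF star_ideal_null_L]
  by (simp add: field_class_def local_class_zero field_algebra_def cstar_completion_def)

text \<open>Membership and value are proved together, because adding the next summand requires the
  partial sum to be a Cauchy representative.\<close>

lemma field_class_sum:
  assumes "finite S" "\<And>i. i \<in> S \<Longrightarrow> p i \<in> cauchy_reps"
  shows "(\<lambda>n. \<Sum>i\<in>S. p i n) \<in> cauchy_reps \<and> (\<Oplus>\<^bsub>A\<^esub>i\<in>S. field_class (p i)) = field_class (\<lambda>n. \<Sum>i\<in>S. p i n)"
proof -
  interpret A: star_ring A by (rule star_ring_A)
  show ?thesis
    using assms
  proof (induction S rule: finite_induct)
    case empty
    then show ?case by (simp add: field_class_zero cauchy_reps_const)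
  next
    case (insert i S)
    then have IH: "(\<lambda>n. \<Sum>i\<in>S. p i n) \<in> cauchy_reps"
      "(\<Oplus>\<^bsub>A\<^esub>i\<in>S. field_class (p i)) = field_class (\<lambda>n. \<Sum>i\<in>S. p i n)" and i: "p i \<in> cauchy_reps" by auto
    have "(\<Oplus>\<^bsub>A\<^esub>j\<in>insert i S. field_class (p j)) = field_class (p i) \<oplus>\<^bsub>A\<^esub> (\<Oplus>\<^bsub>A\<^esub>j\<in>S. field_class (p j))"
      using insert by (intro A.finsum_insert) (auto simp: A_carrier)
    then show ?case using field_class_add[OF i IH(1)] IH insert.hyps by simp
  qed
qed

text \<open>The bound in \<open>env_norm_average\<close> allows the action to be extended termwise
  to Cauchy sequences.\<close>

lemma field_class_act:
  assumes p: "p \<in> cauchy_reps"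
  shows "(\<lambda>n. free_average G (p n)) \<in> cauchy_reps" and "\<Gamma> (field_class p) = field_class (\<lambda>n. free_average G (p n))"
proof -
  let ?f = "local_act G H (z_double G)"
  have f: "0 \<le> real (order G)" "\<And>x. x \<in> carrier L \<Longrightarrow> ?f x \<in> carrier L"
    "\<And>x y. \<lbrakk>x \<in> carrier L; y \<in> carrier L\<rbrakk> \<Longrightarrow> ?f (x \<oplus>\<^bsub>L\<^esub> y) = ?f x \<oplus>\<^bsub>L\<^esub> ?f y"
    "\<And>x. x \<in> carrier L \<Longrightarrow> env_norm L (?f x) \<le> real (order G) * env_norm L x"
    by (auto simp: L_carrier local_act_local_class local_class_add free_average_linear env_norm_average)
  have "(\<lambda>n. ?f (local_class (p n))) \<in> carrier C"
    using f cauchy_repsD(2)[OF p] by (rule bounded_star_ring.completion_extend_coset(1)[OF bounded_star_ring_L])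
  then show "(\<lambda>n. free_average G (p n)) \<in> cauchy_reps"
    using p by (simp add: cauchy_reps_def local_act_local_class)
  have "completion_extend L ?f (field_class p) = null_sequences L +>\<^bsub>C\<^esub> (\<lambda>n. ?f (local_class (p n)))"
    unfolding field_class_def using f cauchy_repsD(2)[OF p]
    by (rule bounded_star_ring.completion_extend_coset(2)[OF bounded_star_ring_L])
  then show "\<Gamma> (field_class p) = field_class (\<lambda>n. free_average G (p n))"
    using p by (simp add: field_act_def cauchy_reps_def local_act_local_class field_class_def)
qed

lemma field_of_free_class: "field_of_free G H p = field_class (\<lambda>n. p)"
  by (simp add: field_of_free_def completion_embed_def field_class_def local_class_def)

lemma field_class_cong:
  assumes "\<And>n. p n \<approx> q n" shows "field_class p = field_class q"
  using local_class_eqI[OF assms] by (simp add: field_class_def)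

lemma basis_elem_field_class:
  assumes "x \<in> carrier G" "y \<in> H"
  shows "complex_of_real (sqrt (real (order G))) \<odot>\<^bsub>A\<^esub> (delta G H x k \<otimes>\<^bsub>A\<^esub> rho G H y (of_int k + 1/2))
    = field_class (\<lambda>n. basis_elem k (x, y))"
proof -
  have "delta G H x k \<otimes>\<^bsub>A\<^esub> rho G H y (of_int k + 1/2) = field_class (\<lambda>n. free_word [Delta x k, Rho y (of_int k + 1/2)])"
    using field_class_mult(2)[of "\<lambda>n. fdelta x k" "\<lambda>n. frho y (of_int k + 1/2)"] assms
    by (simp add: delta_def rho_def field_of_free_class cauchy_reps_const free_word_append)
  then show ?thesis
    using assms by (simp add: field_class_smult cauchy_reps_const basis_elem_def)
qed

text \<open>All operations, including the action, are termwise on representatives, so both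
  identities reduce to \<open>quasi_basis_free\<close> for each term of a sequence.\<close>

theorem quasi_basis_field:
  "quasi_basis A (observable_algebra G H) \<Gamma> (carrier G \<times> H)
    (\<lambda>(x, y). complex_of_real (sqrt (real (order G))) \<odot>\<^bsub>A\<^esub>
       (delta G H x k \<otimes>\<^bsub>A\<^esub> rho G H y (of_int k + 1/2)))" (is "quasi_basis A _ _ ?S ?u")
proof -
  interpret A: star_ring A by (rule star_ring_A)
  have u: "?u i = field_class (\<lambda>n. basis_elem k i)" if "i \<in> ?S" for i
    using that basis_elem_field_class by (cases i) auto
  have uC: "(\<lambda>n. basis_elem k i) \<in> cauchy_reps" if "i \<in> ?S" for i
    using that by (intro cauchy_reps_const F_basis_elem)
  have fS: "finite ?S" using finite_G finite_H by simp
  have "\<Gamma> X \<in> observable_algebra G H" if "X \<in> carrier A" for X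
  proof -
    from that obtain p where p: "p \<in> cauchy_reps" "X = field_class p" by (auto simp: A_carrier)
    \<comment> \<open>Idempotence of the average, applied termwise, makes the value a fixed point
      and hence an observable.\<close>
    have "\<Gamma> (\<Gamma> X) = \<Gamma> X"
      using p field_class_act[OF p(1)] field_class_act(2)[OF field_class_act(1)[OF p(1)]]
      by (simp add: free_average_idem cauchy_repsD(1))
    then show ?thesis using p field_class_act[OF p(1)] by (auto simp: observable_algebra_def A_carrier)
  qed
  moreover have "?u \<in> ?S \<rightarrow> carrier A"
    using u uC by (auto simp: A_carrier simp del: split_paired_All)
  moreover have "(\<Oplus>\<^bsub>A\<^esub>i\<in>?S. ?u i \<otimes>\<^bsub>A\<^esub> \<Gamma> (adj A (?u i) \<otimes>\<^bsub>A\<^esub> X)) = X"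
    "(\<Oplus>\<^bsub>A\<^esub>i\<in>?S. \<Gamma> (X \<otimes>\<^bsub>A\<^esub> ?u i) \<otimes>\<^bsub>A\<^esub> adj A (?u i)) = X" if "X \<in> carrier A" for X
  proof -
    from that obtain p where p: "p \<in> cauchy_reps" "X = field_class p" by (auto simp: A_carrier)
    let ?l = "\<lambda>i n. basis_elem k i * free_average G (free_adj G (basis_elem k i) * p n)"
    let ?r = "\<lambda>i n. free_average G (p n * basis_elem k i) * free_adj G (basis_elem k i)"
    \<comment> \<open>The operations are evaluated from the inside out, each one supplying the
      Cauchy representative that the next requires.\<close>
    have l: "?l i \<in> cauchy_reps" "?u i \<otimes>\<^bsub>A\<^esub> \<Gamma> (adj A (?u i) \<otimes>\<^bsub>A\<^esub> X) = field_class (?l i)" if i: "i \<in> ?S" for i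
    proof -
      note a = field_class_adj[OF uC[OF i]]
      note b = field_class_mult[OF a(1) p(1)]
      note c = field_class_act[OF b(1)]
      note d = field_class_mult[OF uC[OF i] c(1)]
      show "?l i \<in> cauchy_reps" by (rule d(1))
      show "?u i \<otimes>\<^bsub>A\<^esub> \<Gamma> (adj A (?u i) \<otimes>\<^bsub>A\<^esub> X) = field_class (?l i)"
        by (simp only: u[OF i] p(2) a(2) b(2) c(2) d(2))
    qed
    have r: "?r i \<in> cauchy_reps" "\<Gamma> (X \<otimes>\<^bsub>A\<^esub> ?u i) \<otimes>\<^bsub>A\<^esub> adj A (?u i) = field_class (?r i)" if i: "i \<in> ?S" for i
    proof -
      note a = field_class_adj[OF uC[OF i]]
      note b = field_class_mult[OF p(1) uC[OF i]]
      note c = field_class_act[OF b(1)]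
      note d = field_class_mult[OF c(1) a(1)]
      show "?r i \<in> cauchy_reps" by (rule d(1))
      show "\<Gamma> (X \<otimes>\<^bsub>A\<^esub> ?u i) \<otimes>\<^bsub>A\<^esub> adj A (?u i) = field_class (?r i)"
        by (simp only: u[OF i] p(2) a(2) b(2) c(2) d(2))
    qed
    have "(\<Oplus>\<^bsub>A\<^esub>i\<in>?S. ?u i \<otimes>\<^bsub>A\<^esub> \<Gamma> (adj A (?u i) \<otimes>\<^bsub>A\<^esub> X)) = (\<Oplus>\<^bsub>A\<^esub>i\<in>?S. field_class (?l i))"
      by (rule A.finsum_cong'[OF refl _ l(2)]) (auto simp: A_carrier intro!: imageI l(1))
    also have "\<dots> = field_class (\<lambda>n. \<Sum>i\<in>?S. ?l i n)"
      using field_class_sum[OF fS, of ?l] l(1) by blast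
    \<comment> \<open>The congruence holds for every term, so the two sequences of local classes are
      equal, not merely equal up to a null sequence.\<close>
    also have "\<dots> = X"
      unfolding p(2) by (rule field_class_cong) (rule quasi_basis_free(1)[OF cauchy_repsD(1)[OF p(1)]])
    finally show "(\<Oplus>\<^bsub>A\<^esub>i\<in>?S. ?u i \<otimes>\<^bsub>A\<^esub> \<Gamma> (adj A (?u i) \<otimes>\<^bsub>A\<^esub> X)) = X" .
    have "(\<Oplus>\<^bsub>A\<^esub>i\<in>?S. \<Gamma> (X \<otimes>\<^bsub>A\<^esub> ?u i) \<otimes>\<^bsub>A\<^esub> adj A (?u i)) = (\<Oplus>\<^bsub>A\<^esub>i\<in>?S. field_class (?r i))"
      by (rule A.finsum_cong'[OF refl _ r(2)]) (auto simp: A_carrier intro!: imageI r(1))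
    also have "\<dots> = field_class (\<lambda>n. \<Sum>i\<in>?S. ?r i n)"
      using field_class_sum[OF fS, of ?r] r(1) by blast
    also have "\<dots> = X"
      unfolding p(2) by (rule field_class_cong) (rule quasi_basis_free(2)[OF cauchy_repsD(1)[OF p(1)]])
    finally show "(\<Oplus>\<^bsub>A\<^esub>i\<in>?S. \<Gamma> (X \<otimes>\<^bsub>A\<^esub> ?u i) \<otimes>\<^bsub>A\<^esub> adj A (?u i)) = X" .
  qed
  ultimately show ?thesis unfolding quasi_basis_def using fS by blast
qed

end

theorem theorem3p1:
  fixes G :: "('g, 'm) monoid_scheme" and H :: "'g set" and k :: int
  assumes "group G" and "finite (carrier G)" and "H \<lhd> G"
  shows "quasi_basis (field_algebra G H) (observable_algebra G H) (field_act G H (z_double G))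
    (carrier G \<times> H)
    (\<lambda>(x, y). complex_of_real (sqrt (real (order G))) \<odot>\<^bsub>field_algebra G H\<^esub>
       (delta G H x k \<otimes>\<^bsub>field_algebra G H\<^esub> rho G H y (of_int k + 1/2)))"
proof -
  interpret field_net H G
    using assms by (simp add: field_net_def field_net_axioms_def)
  show ?thesis by (rule quasi_basis_field)
qed

end
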